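(* Let $\alpha>0$, $k\ge2$, and let $\mu$ be a probability measure on $[a,b]$ with strictly positive Lebesgue density of class $C^{k-1}([a,b])$. Then the manifold $\mathcal{D}^k$ of $C^k$-diffeomorphisms of $[a,b]$ fixing the endpoints is geodesically complete with respect to the dual geodesics induced by the potential $$\psi(\Phi)=\int_a^b\frac{(\Phi(x)-x)^2}{2}-\alpha\log(\partial_x\Phi(x))\,d\mu(x),$$ that is: for every $\bar\Phi\in\mathcal{D}^k$ and every $u\in C^k([a,b])$ with $u(a)=u(b)=0$ there exists a dual geodesic $t\mapsto\Phi_t\in\mathcal{D}^k$ of $\psi$, defined for all $t\in[0,\infty)$ and of class $C^2([0,\infty);C^k([a,b]))$, with $\Phi_0=\bar\Phi$ and $\dot\Phi_0=u$.
   Context: Fix reals $a<b$. $\mathcal{D}^k=\{\Phi\in C^k([a,b]):\Phi(a)=a,\ \Phi(b)=b,\ \partial_x\Phi>0\}$. A dual geodesic induced by $\psi$ is a curve $t\mapsto\Phi_t\in\mathcal{D}^k$ satisfying $\ddot\Phi_t+[\mathrm{D}^2\psi(\Phi_t)]^{-1}[\mathrm{D}^3\psi(\Phi_t)](\dot\Phi_t,\dot\Phi_t)=0$, i.e. $\mathrm{D}^2\psi(\Phi_t)(\ddot\Phi_t,\varphi)+\mathrm{D}^3\psi(\Phi_t)(\dot\Phi_t,\dot\Phi_t,\varphi)=0$ for all $\varphi\in C_0^\infty((a,b))$, where $\mathrm{D}^j\psi$ are the iterated directional derivatives; explicitly, $$\int_a^b\varphi\,\ddot\Phi_t+\alpha\frac{\partial_x\varphi\,\partial_x\ddot\Phi_t}{(\partial_x\Phi_t)^2}-2\alpha\frac{\partial_x\varphi\,(\partial_x\dot\Phi_t)^2}{(\partial_x\Phi_t)^3}\,d\mu=0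 .$$ *)

theory Defs
  imports "HOL-Probability.Probability"
begin

text \<open>Functions on [a,b] are represented by functions \<open>real \<Rightarrow> real\<close> whose values outside
  \<open>{a..b}\<close> are irrelevant. The derivative is taken within \<open>{a..b}\<close>, hence is one-sided at the
  two endpoints.\<close>

definition dx :: "real \<Rightarrow> real \<Rightarrow> (real \<Rightarrow> real) \<Rightarrow> real \<Rightarrow> real" where
  "dx a b f = (\<lambda>x. vector_derivative f (at x within {a..b}))"

fun Ck :: "real \<Rightarrow> real \<Rightarrow> nat \<Rightarrow> (real \<Rightarrow> real) set" where
  "Ck a b 0 = {f. continuous_on {a..b} f}"
| "Ck a b (Suc k) = {f. f differentiable_on {a..b} \<and> dx a b f \<in> Ck a b k}"

text \<open>The usual Banach norm of \<open>C\<^sup>k([a,b])\<close>; it is only meaningful on members of \<open>Ck a b k\<close>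
  (otherwise the suprema may be unspecified).\<close>

definition Ck_norm :: "real \<Rightarrow> real \<Rightarrow> nat \<Rightarrow> (real \<Rightarrow> real) \<Rightarrow> real" where
  "Ck_norm a b k f = (\<Sum>j\<le>k. SUP x\<in>{a..b}. \<bar>(dx a b ^^ j) f x\<bar>)"

definition Diffeo :: "real \<Rightarrow> real \<Rightarrow> nat \<Rightarrow> (real \<Rightarrow> real) set" where
  "Diffeo a b k = {\<Phi> \<in> Ck a b k. \<Phi> a = a \<and> \<Phi> b = b \<and> (\<forall>x\<in>{a..b}. dx a b \<Phi> x > 0)}"

text \<open>\<open>C\<^sub>0\<^sup>\<infinity>((a,b))\<close>: smooth functions, extended by zero, with compact support inside the open
  interval (the closed support is compact because it is bounded).\<close>

definition test_functions :: "real \<Rightarrow> real \<Rightarrow> (real \<Rightarrow> real) set" where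
  "test_functions a b =
     {\<phi>. (\<forall>n. \<phi> \<in> Ck a b n) \<and> closure {x. \<phi> x \<noteq> 0} \<subseteq> {a<..<b}}"

text \<open>Curves \<open>[0,\<infinity>) \<rightarrow> C\<^sup>k([a,b])\<close>, with continuity and derivatives understood in the norm
  of \<open>C\<^sup>k([a,b])\<close> (one-sided at time 0).\<close>

definition Ck_curve_continuous ::
  "real \<Rightarrow> real \<Rightarrow> nat \<Rightarrow> (real \<Rightarrow> real \<Rightarrow> real) \<Rightarrow> bool" where
  "Ck_curve_continuous a b k \<gamma> \<longleftrightarrow>
     (\<forall>t\<ge>0. \<gamma> t \<in> Ck a b k \<and>
        ((\<lambda>s. Ck_norm a b k (\<lambda>x. \<gamma> s x - \<gamma> t x)) \<longlongrightarrow> 0) (at t within {0..}))"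

definition Ck_curve_has_deriv ::
  "real \<Rightarrow> real \<Rightarrow> nat \<Rightarrow> (real \<Rightarrow> real \<Rightarrow> real) \<Rightarrow> (real \<Rightarrow> real \<Rightarrow> real) \<Rightarrow> bool" where
  "Ck_curve_has_deriv a b k \<gamma> \<gamma>' \<longleftrightarrow>
     (\<forall>t\<ge>0. \<gamma> t \<in> Ck a b k \<and> \<gamma>' t \<in> Ck a b k \<and>
        ((\<lambda>s. Ck_norm a b k (\<lambda>x. (\<gamma> s x - \<gamma> t x) / (s - t) - \<gamma>' t x)) \<longlongrightarrow> 0)
          (at t within {0..}))"

definition Ck_curve_C2 ::
  "real \<Rightarrow> real \<Rightarrow> nat \<Rightarrow> (real \<Rightarrow> real \<Rightarrow> real) \<Rightarrow> (real \<Rightarrow> real \<Rightarrow> real) \<Rightarrow>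
     (real \<Rightarrow> real \<Rightarrow> real) \<Rightarrow> bool" where
  "Ck_curve_C2 a b k \<gamma> \<gamma>' \<gamma>'' \<longleftrightarrow>
     Ck_curve_has_deriv a b k \<gamma> \<gamma>' \<and> Ck_curve_has_deriv a b k \<gamma>' \<gamma>'' \<and>
     Ck_curve_continuous a b k \<gamma>''"

definition psi :: "real \<Rightarrow> real \<Rightarrow> real \<Rightarrow> real measure \<Rightarrow> (real \<Rightarrow> real) \<Rightarrow> real" where
  "psi a b \<alpha> \<mu> \<Phi> = (LINT x|\<mu>. (\<Phi> x - x)\<^sup>2 / 2 - \<alpha> * ln (dx a b \<Phi> x))"

text \<open>Iterated directional derivatives; the arguments of \<open>D2 F \<Phi> h\<^sub>1 h\<^sub>2\<close> and
  \<open>D3 F \<Phi> h\<^sub>1 h\<^sub>2 h\<^sub>3\<close> are the directions, and the last one is differentiated first.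
  For \<open>\<Phi>\<close> in \<open>Diffeo a b k\<close> and directions in \<open>Ck a b k\<close> (\<open>k \<ge> 1\<close>), the derivative of
  \<open>\<Phi> + s h\<close> stays positive on \<open>[a,b]\<close> for small \<open>\<bar>s\<bar>\<close>, so all the derivatives below
  exist for \<open>F = psi a b \<alpha> \<mu>\<close> when \<open>\<mu>\<close> is a probability measure on \<open>[a,b]\<close>.\<close>

definition dir_deriv ::
  "((real \<Rightarrow> real) \<Rightarrow> real) \<Rightarrow> (real \<Rightarrow> real) \<Rightarrow> (real \<Rightarrow> real) \<Rightarrow> real" where
  "dir_deriv F \<Phi> h = deriv (\<lambda>s. F (\<lambda>x. \<Phi> x + s * h x)) 0"

definition D2 ::
  "((real \<Rightarrow> real) \<Rightarrow> real) \<Rightarrow> (real \<Rightarrow> real) \<Rightarrow> (real \<Rightarrow> real) \<Rightarrow> (real \<Rightarrow> real) \<Rightarrow> real" where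
  "D2 F \<Phi> h\<^sub>1 h\<^sub>2 = dir_deriv (\<lambda>\<Psi>. dir_deriv F \<Psi> h\<^sub>2) \<Phi> h\<^sub>1"

definition D3 ::
  "((real \<Rightarrow> real) \<Rightarrow> real) \<Rightarrow> (real \<Rightarrow> real) \<Rightarrow> (real \<Rightarrow> real) \<Rightarrow> (real \<Rightarrow> real) \<Rightarrow>
     (real \<Rightarrow> real) \<Rightarrow> real" where
  "D3 F \<Phi> h\<^sub>1 h\<^sub>2 h\<^sub>3 = dir_deriv (\<lambda>\<Psi>. D2 F \<Psi> h\<^sub>2 h\<^sub>3) \<Phi> h\<^sub>1"

text \<open>The curve \<open>\<Phi>\<close> with velocity \<open>\<Phi>'\<close> and acceleration \<open>\<Phi>''\<close> is a dual geodesic of the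
  potential \<open>F\<close> on the time interval \<open>[0,\<infinity>)\<close>.\<close>

definition dual_geodesic ::
  "real \<Rightarrow> real \<Rightarrow> nat \<Rightarrow> ((real \<Rightarrow> real) \<Rightarrow> real) \<Rightarrow> (real \<Rightarrow> real \<Rightarrow> real) \<Rightarrow>
     (real \<Rightarrow> real \<Rightarrow> real) \<Rightarrow> (real \<Rightarrow> real \<Rightarrow> real) \<Rightarrow> bool" where
  "dual_geodesic a b k F \<Phi> \<Phi>' \<Phi>'' \<longleftrightarrow>
     Ck_curve_has_deriv a b k \<Phi> \<Phi>' \<and> Ck_curve_has_deriv a b k \<Phi>' \<Phi>'' \<and>
     (\<forall>t\<ge>0. \<Phi> t \<in> Diffeo a b k \<and>
        (\<forall>\<phi>\<in>test_functions a b.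
           D2 F (\<Phi> t) (\<Phi>'' t) \<phi> + D3 F (\<Phi> t) (\<Phi>' t) (\<Phi>' t) \<phi> = 0))"

end

theory Submission
  imports Defs
begin

text \<open>
  A dual geodesic is a straight line in the dual coordinate \<open>D\<psi>(\<Phi>)\<close>, and this is what makes
  global existence accessible: \<open>\<Phi>\<^sub>t\<close> is determined separately for each \<open>t\<close>. Integrating
  \<open>D\<psi>(\<Phi>)(\<phi>) = \<integral> (\<Phi> - x) \<phi> - \<alpha> \<phi>' / \<Phi>' d\<mu>\<close> by parts and putting \<open>y = \<alpha> \<rho> / \<Phi>'\<close>,
  linearity in time says that \<open>y\<^sub>t + \<integral>\<^sub>a \<rho> \<Phi>\<^sub>t\<close> is affine in \<open>t\<close> up to a constant depending on
  \<open>t\<close> only, that is \<open>y\<^sub>t = y\<^sub>0 + t h - q\<^sub>t\<close> where \<open>q\<^sub>t' = \<rho> (\<Phi>\<^sub>t - \<Phi>\<^sub>0)\<close> and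
  \<open>h = \<integral>\<^sub>a \<rho> u - \<alpha> \<rho> u' / \<Phi>\<^sub>0'\<^sup>2\<close>. With \<open>v\<^sub>t = \<Phi>\<^sub>t - \<Phi>\<^sub>0\<close> this is the Neumann problem
  \<open>q' = \<rho> v\<close>, \<open>v' = \<rho> (\<alpha> / (y\<^sub>0 + t h - q) - \<alpha> / y\<^sub>0)\<close>, \<open>v a = v b = 0\<close>,
  in which the free constant has become the Neumann freedom in \<open>q\<close>.

  The right-hand side increases with \<open>q\<close>, so the maximum principle (\<open>neumann_max\<close>) applies. It
  gives a contraction argument for existence when the nonlinearity has slope bounded above and
  away from zero (\<open>neumann_semilinear\<close>), the bound \<open>\<bar>q\<^sub>t\<bar> \<le> t sup \<bar>h\<bar>\<close>, and stability under
  perturbation of the coefficients (\<open>neumann_linear_limit\<close>). The real point is that the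
  singularity \<open>y = 0\<close>, where \<open>\<Phi>\<^sub>t'\<close> blows up, is not reached (\<open>neumann_singular\<close>). Because
  \<open>k \<ge> 2\<close>, the data \<open>y\<^sub>0\<close> and \<open>h\<close> are Lipschitz and hence so is \<open>y\<^sub>t\<close>; if \<open>y\<^sub>t\<close> took a value
  below \<open>\<epsilon>\<close>, then \<open>\<integral> \<alpha> \<rho> / y\<^sub>t\<close> would be at least a multiple of \<open>ln (1 / \<epsilon>)\<close>, but this
  integral is \<open>\<Phi>\<^sub>t b - \<Phi>\<^sub>t a = b - a\<close>.

  Difference quotients in time of solutions solve linear Neumann problems with converging
  coefficients, so stability yields two time derivatives (\<open>singular_evolution\<close>). Feeding
  \<open>q' = \<rho> v\<close> and the equation for \<open>v'\<close> into each other raises the regularity in space up to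
  \<open>C\<^sup>k\<close> (\<open>singular_evolution_smooth\<close>). Finally the Hessian and the third derivative of the
  potential are computed under the integral sign, and the geodesic equation becomes
  \<open>\<integral> \<rho> \<phi> v'' + \<phi>' q'' dx = 0\<close>, the primes on \<open>v\<close> and \<open>q\<close> being time derivatives; this is
  the integral of the space derivative of \<open>\<phi> q''\<close>.
\<close>

section \<open>The weighted Neumann problem\<close>

text \<open>Stated for two unordered points, so that arguments at a maximum need no separate treatment
  of the two endpoints.\<close>
lemma mvt_between:
  fixes f :: "real \<Rightarrow> real"
  assumes der: "\<And>x. x \<in> {a..b} \<Longrightarrow> (f has_real_derivative f' x) (at x within {a..b})"
    and "x0 \<in> {a..b}" "x1 \<in> {a..b}" "x0 \<noteq> x1"
  shows "\<exists>\<xi>\<in>{a..b}. f x1 - f x0 = f' \<xi> * (x1 - x0) \<and> \<bar>\<xi> - x0\<bar> < \<bar>x1 - x0\<bar> \<and> (\<xi> - x0) * (x1 - x0) > 0"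
proof -
  define l r where "l = min x0 x1" and "r = max x0 x1"
  have lr: "l < r" "a \<le> l" "r \<le> b" using assms by (auto simp: l_def r_def)
  have "\<exists>\<xi>\<in>{l<..<r}. f r - f l = (\<lambda>h. h * f' \<xi>) (r - l)"
  proof (rule mvt_simple[OF lr(1)])
    fix x assume "l \<le> x" "x \<le> r"
    then have "(f has_real_derivative f' x) (at x within {l..r})"
      using lr by (intro DERIV_subset[OF der[of x]]) auto
    then show "(f has_derivative (\<lambda>h. h * f' x)) (at x within {l..r})"
      by (simp add: has_field_derivative_def mult_commute_abs)
  qed
  then obtain \<xi> where \<xi>: "l < \<xi>" "\<xi> < r" "f r - f l = f' \<xi> * (r - l)" by auto
  show ?thesis
  proof (cases "x0 < x1")
    case True
    then have "l = x0" "r = x1" by (auto simp: l_def r_def)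
    with \<xi> lr show ?thesis by (intro bexI[of _ \<xi>]) (auto intro: mult_pos_pos)
  next
    case False
    then have "l = x1" "r = x0" using assms by (auto simp: l_def r_def)
    with \<xi> lr show ?thesis
      by (intro bexI[of _ \<xi>]) (auto intro!: mult_neg_neg simp: right_diff_distrib)
  qed
qed

lemma integral_antiderivative:
  fixes f :: "real \<Rightarrow> real"
  assumes "continuous_on {a..b} f"
  obtains F where "F a = 0"
    and "\<And>x. x \<in> {a..b} \<Longrightarrow> (F has_real_derivative f x) (at x within {a..b})"
  using that[of "\<lambda>x. integral {a..x} f"] integral_has_real_derivative[OF assms] by auto

locale weighted_interval =
  fixes a b :: real and \<rho> :: "real \<Rightarrow> real"
  assumes ab: "a < b"
    and \<rho>_cont: "continuous_on {a..b} \<rho>"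
    and \<rho>_pos: "x \<in> {a..b} \<Longrightarrow> \<rho> x > 0"
begin

text \<open>The problem \<open>(q' / \<rho>)' / \<rho> = r\<close> with homogeneous Neumann conditions, as a first-order
  system: \<open>\<rho>\<close> need not be differentiable, and the flux \<open>v\<close> is the displacement of the
  diffeomorphism.\<close>
definition neumann :: "(real \<Rightarrow> real) \<Rightarrow> (real \<Rightarrow> real) \<Rightarrow> (real \<Rightarrow> real) \<Rightarrow> bool" where
  "neumann q v r \<longleftrightarrow> v a = 0 \<and> v b = 0 \<and> continuous_on {a..b} r \<and>
     (\<forall>x\<in>{a..b}. (q has_real_derivative \<rho> x * v x) (at x within {a..b}) \<and>
        (v has_real_derivative \<rho> x * r x) (at x within {a..b}))"

lemma neumannD:
  assumes "neumann q v r"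
  shows "v a = 0" "v b = 0" "continuous_on {a..b} r"
    "\<And>x. x \<in> {a..b} \<Longrightarrow> (q has_real_derivative \<rho> x * v x) (at x within {a..b})"
    "\<And>x. x \<in> {a..b} \<Longrightarrow> (v has_real_derivative \<rho> x * r x) (at x within {a..b})"
    "continuous_on {a..b} q" "continuous_on {a..b} v"
  using assms unfolding neumann_def
  by (auto intro!: DERIV_continuous_on)

lemma neumann_cong:
  assumes "neumann q v r" "\<And>x. x \<in> {a..b} \<Longrightarrow> r x = r' x"
  shows "neumann q v r'"
proof -
  have "continuous_on {a..b} r'"
    using neumannD(3)[OF assms(1)] assms(2) by (metis continuous_on_cong)
  then show ?thesis using assms unfolding neumann_def by auto
qed

lemma neumann_diff:
  assumes "neumann q v r" "neumann q' v' r'"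
  shows "neumann (\<lambda>x. q x - q' x) (\<lambda>x. v x - v' x) (\<lambda>x. r x - r' x)"
  using assms unfolding neumann_def
  by (auto intro!: continuous_intros derivative_eq_intros simp: algebra_simps)

lemma neumann_cmult:
  assumes "neumann q v r"
  shows "neumann (\<lambda>x. c * q x) (\<lambda>x. c * v x) (\<lambda>x. c * r x)"
  using assms unfolding neumann_def
  by (auto intro!: continuous_intros derivative_eq_intros simp: algebra_simps)

text \<open>The maximum principle. The Neumann condition makes \<open>v\<close> vanish at a maximum of \<open>q\<close> even when
  this is an endpoint, so the second-order test applies there as well.\<close>
lemma neumann_max:
  assumes N: "neumann q v r"
    and pos: "\<And>x. x \<in> {a..b} \<Longrightarrow> q x > K \<Longrightarrow> r x > 0"
    and x: "x \<in> {a..b}"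
  shows "q x \<le> K"
proof (rule ccontr)
  assume *: "\<not> q x \<le> K"
  obtain x0 where x0: "x0 \<in> {a..b}" "\<And>y. y \<in> {a..b} \<Longrightarrow> q y \<le> q x0"
    using continuous_attains_sup[of "{a..b}" q] neumannD(6)[OF N] x by auto
  have "q x0 > K" using x0(2)[OF x] * by simp
  then have r0: "r x0 > 0" using pos x0 by blast
  have v0: "v x0 = 0"
  proof (cases "x0 = a \<or> x0 = b")
    case True then show ?thesis using neumannD(1,2)[OF N] by auto
  next
    case False
    with x0 have i: "a < x0" "x0 < b" by auto
    have "(q has_real_derivative \<rho> x0 * v x0) (at x0)"
      using neumannD(4)[OF N x0(1)] i by (simp add: at_within_Icc_at)
    moreover have "0 < min (x0 - a) (b - x0)" using i by auto
    ultimately have "\<rho> x0 * v x0 = 0"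
      by (rule DERIV_local_max) (auto intro!: x0(2))
    then show ?thesis using \<rho>_pos[OF x0(1)] by simp
  qed
  obtain \<delta> where \<delta>: "\<delta> > 0" "\<And>y. y \<in> {a..b} \<Longrightarrow> \<bar>y - x0\<bar> < \<delta> \<Longrightarrow> r y > 0"
  proof -
    have "continuous (at x0 within {a..b}) r"
      using neumannD(3)[OF N] x0(1) by (simp add: continuous_on_eq_continuous_within)
    then obtain d where "d > 0" "\<forall>y\<in>{a..b}. dist y x0 < d \<longrightarrow> dist (r y) (r x0) < r x0"
      using r0 unfolding continuous_within_eps_delta by blast
    then show ?thesis using that[of d] by (force simp: dist_real_def)
  qed
  define x1 where "x1 = (if x0 < b then min b (x0 + \<delta>/2) else max a (x0 - \<delta>/2))"
  have x1: "x1 \<in> {a..b}" "x0 \<noteq> x1" "\<bar>x1 - x0\<bar> < \<delta>"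
    using ab \<delta>(1) x0(1) by (auto simp: x1_def)
  \<comment> \<open>Two applications of the mean value theorem replace a second-order Taylor expansion at the maximum.\<close>
  obtain \<xi> where \<xi>: "\<xi> \<in> {a..b}" "q x1 - q x0 = \<rho> \<xi> * v \<xi> * (x1 - x0)"
    "\<bar>\<xi> - x0\<bar> < \<bar>x1 - x0\<bar>" "(\<xi> - x0) * (x1 - x0) > 0"
    using mvt_between[where f=q and f'="\<lambda>x. \<rho> x * v x", OF neumannD(4)[OF N] x0(1) x1(1,2)] by blast
  then have "x0 \<noteq> \<xi>" by auto
  then obtain \<eta> where \<eta>: "\<eta> \<in> {a..b}" "v \<xi> - v x0 = \<rho> \<eta> * r \<eta> * (\<xi> - x0)" "\<bar>\<eta> - x0\<bar> < \<bar>\<xi> - x0\<bar>"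
    using mvt_between[where f=v and f'="\<lambda>x. \<rho> x * r x", OF neumannD(5)[OF N] x0(1) \<xi>(1)] by blast
  have "q x1 - q x0 = \<rho> \<xi> * \<rho> \<eta> * r \<eta> * ((\<xi> - x0) * (x1 - x0))"
    using \<xi>(2) \<eta>(2) v0 by simp
  moreover have "r \<eta> > 0" using \<delta>(2)[OF \<eta>(1)] \<eta>(3) \<xi>(3) x1(3) by simp
  ultimately have "q x1 > q x0"
    using \<xi>(4) \<rho>_pos[OF \<xi>(1)] \<rho>_pos[OF \<eta>(1)] by (metis diff_gt_0_iff_gt mult_pos_pos)
  then show False using x0(2)[OF x1(1)] by simp
qed

lemma neumann_min:
  assumes "neumann q v r"
    and "\<And>x. x \<in> {a..b} \<Longrightarrow> q x < K \<Longrightarrow> r x < 0"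
    and "x \<in> {a..b}"
  shows "q x \<ge> K"
  using neumann_max[OF neumann_cmult[OF assms(1), of "-1"], of "-K" x] assms by auto

lemma neumann_linear_bound:
  assumes N: "neumann q v (\<lambda>x. p x * q x + s x)" and "m > 0"
    and p: "\<And>x. x \<in> {a..b} \<Longrightarrow> p x \<ge> m"
    and s: "\<And>x. x \<in> {a..b} \<Longrightarrow> \<bar>s x\<bar> \<le> K"
    and x: "x \<in> {a..b}"
  shows "\<bar>q x\<bar> \<le> K / m"
proof -
  have K: "K \<ge> 0" using s[OF x] by linarith
  have "q x \<le> K / m"
  proof (rule neumann_max[OF N _ x])
    fix y assume y: "y \<in> {a..b}" "q y > K / m"
    then have "0 \<le> q y" using K \<open>m > 0\<close> by (smt (verit) divide_nonneg_pos)
    then have "p y * q y \<ge> m * q y" using p[OF y(1)] by (intro mult_right_mono)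
    moreover have "m * q y > K" using y(2) \<open>m > 0\<close> by (simp add: field_simps)
    ultimately show "p y * q y + s y > 0" using s[OF y(1)] by linarith
  qed
  moreover have "q x \<ge> - (K / m)"
  proof (rule neumann_min[OF N _ x])
    fix y assume y: "y \<in> {a..b}" "q y < - (K / m)"
    then have "q y \<le> 0" using K \<open>m > 0\<close> by (smt (verit) divide_nonneg_pos)
    then have "p y * q y \<le> m * q y" using p[OF y(1)] by (intro mult_right_mono_neg)
    moreover have "m * q y < - K" using y(2) \<open>m > 0\<close> by (simp add: field_simps)
    ultimately show "p y * q y + s y < 0" using s[OF y(1)] by linarith
  qed
  ultimately show ?thesis by linarith
qed

text \<open>The Green function of \<open>\<kappa>\<^sup>2 - (d/dS)\<^sup>2\<close> in the mass variable \<open>S = \<integral>\<^sub>a \<rho>\<close> of total mass \<open>N\<close> is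
  \<open>cosh (\<kappa> S) cosh (\<kappa> (N - S')) / (\<kappa> sinh (\<kappa> N))\<close> for \<open>S \<le> S'\<close>.\<close>
lemma neumann_resolvent:
  assumes "\<kappa> > 0" and f: "continuous_on {a..b} f"
  shows "\<exists>q v. neumann q v (\<lambda>x. \<kappa>\<^sup>2 * q x - f x)"
proof -
  obtain S where S: "S a = 0"
    "\<And>x. x \<in> {a..b} \<Longrightarrow> (S has_real_derivative \<rho> x) (at x within {a..b})"
    using integral_antiderivative[OF \<rho>_cont] by blast
  define N where "N = S b"
  have Scont: "continuous_on {a..b} S" using S(2) by (intro DERIV_continuous_on)
  have "N > 0"
  proof -
    obtain \<xi> where "\<xi> \<in> {a..b}" "S b - S a = \<rho> \<xi> * (b - a)"
      using mvt_between[OF S(2), of a b] ab by force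
    then show ?thesis using ab \<rho>_pos S(1) by (simp add: N_def)
  qed
  then have sN: "sinh (\<kappa> * N) > 0" using \<open>\<kappa> > 0\<close> by simp
  have [continuous_intros]: "continuous_on {a..b} (\<lambda>x. cosh (\<kappa> * S x))"
      "continuous_on {a..b} (\<lambda>x. cosh (\<kappa> * (N - S x)))"
    unfolding cosh_field_def by (auto intro!: continuous_intros Scont)
  obtain A where A: "A a = 0"
    "\<And>x. x \<in> {a..b} \<Longrightarrow> (A has_real_derivative (cosh (\<kappa> * S x) * \<rho> x * f x)) (at x within {a..b})"
    by (rule integral_antiderivative[of a b "\<lambda>x. cosh (\<kappa> * S x) * \<rho> x * f x"])
       (auto intro!: continuous_intros f \<rho>_cont)
  obtain B where B: "B a = 0"
    "\<And>x. x \<in> {a..b} \<Longrightarrow> (B has_real_derivative (cosh (\<kappa> * (N - S x)) * \<rho> x * f x)) (at x within {a..b})"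
    by (rule integral_antiderivative[of a b "\<lambda>x. cosh (\<kappa> * (N - S x)) * \<rho> x * f x"])
       (auto intro!: continuous_intros f \<rho>_cont)
  define q where "q x = (cosh (\<kappa> * (N - S x)) * A x + cosh (\<kappa> * S x) * (B b - B x)) / (\<kappa> * sinh (\<kappa> * N))" for x
  define v where "v x = (- sinh (\<kappa> * (N - S x)) * A x + sinh (\<kappa> * S x) * (B b - B x)) / sinh (\<kappa> * N)" for x
  have q': "(q has_real_derivative \<rho> x * v x) (at x within {a..b})" if x: "x \<in> {a..b}" for x
  proof -
    have "((\<lambda>x. cosh (\<kappa> * (N - S x)) * A x + cosh (\<kappa> * S x) * (B b - B x)) has_real_derivative
        (\<kappa> * \<rho> x) * (- sinh (\<kappa> * (N - S x)) * A x + sinh (\<kappa> * S x) * (B b - B x))) (at x within {a..b})"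
      by (rule derivative_eq_intros S(2)[OF x] A(2)[OF x] B(2)[OF x] refl | simp)+
         (simp add: algebra_simps)
    from DERIV_cdivide[OF this, of "\<kappa> * sinh (\<kappa> * N)"] show ?thesis
      unfolding q_def v_def by (rule DERIV_cong) (use \<open>\<kappa> > 0\<close> in simp)
  qed
  have v': "(v has_real_derivative \<rho> x * (\<kappa>\<^sup>2 * q x - f x)) (at x within {a..b})" if x: "x \<in> {a..b}" for x
  proof -
    have "sinh (\<kappa> * N) = sinh (\<kappa> * (N - S x)) * cosh (\<kappa> * S x) + cosh (\<kappa> * (N - S x)) * sinh (\<kappa> * S x)"
      using sinh_add[of "\<kappa> * (N - S x)" "\<kappa> * S x"] by (simp add: algebra_simps)
    then have *: "(sinh (\<kappa> * (N - S x)) * cosh (\<kappa> * S x) + cosh (\<kappa> * (N - S x)) * sinh (\<kappa> * S x)) * (\<rho> x * f x)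
       = sinh (\<kappa> * N) * (\<rho> x * f x)"
      by simp
    have "((\<lambda>x. - sinh (\<kappa> * (N - S x)) * A x + sinh (\<kappa> * S x) * (B b - B x)) has_real_derivative
        (\<kappa> * \<rho> x) * (cosh (\<kappa> * (N - S x)) * A x + cosh (\<kappa> * S x) * (B b - B x)) - sinh (\<kappa> * N) * (\<rho> x * f x)) (at x within {a..b})"
      by (rule derivative_eq_intros S(2)[OF x] A(2)[OF x] B(2)[OF x] refl | simp)+
         (subst *[symmetric], simp add: algebra_simps)
    from DERIV_cdivide[OF this, of "sinh (\<kappa> * N)"] show ?thesis
      unfolding v_def
      by (rule DERIV_cong) (use sN \<open>\<kappa> > 0\<close> \<open>N > 0\<close> in \<open>simp add: q_def divide_simps power2_eq_square\<close>; simp add: algebra_simps)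
  qed
  have qc: "continuous_on {a..b} q" using q' by (intro DERIV_continuous_on)
  have "v a = 0" "v b = 0" using S(1) A(1) by (auto simp: v_def N_def)
  then have "neumann q v (\<lambda>x. \<kappa>\<^sup>2 * q x - f x)"
    unfolding neumann_def using q' v' by (auto intro!: continuous_intros qc f)
  then show ?thesis by blast
qed

text \<open>Rewriting the equation as \<open>(L - \<Delta>) q = L q - f x q\<close>, with \<open>\<Delta> q = (q' / \<rho>)' / \<rho>\<close>, the right-hand side has
  Lipschitz constant \<open>L - m\<close> in \<open>q\<close>, while the maximum principle bounds the resolvent
  \<open>(L - \<Delta>)^(-1)\<close> by \<open>1 / L\<close> in the supremum norm: the composition is a contraction.\<close>
lemma neumann_semilinear:
  assumes m: "0 < m" "m \<le> L"
    and f: "continuous_on ({a..b} \<times> UNIV) (\<lambda>(x, z). f x z)"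
    and slope: "\<And>x y z. x \<in> {a..b} \<Longrightarrow> y \<le> z \<Longrightarrow>
        m * (z - y) \<le> f x z - f x y \<and> f x z - f x y \<le> L * (z - y)"
  shows "\<exists>q v. neumann q v (\<lambda>x. f x (q x))"
proof -
  have L: "L > 0" using m by linarith
  have fc: "continuous_on {a..b} (\<lambda>x. f x (z x))" if "continuous_on {a..b} z" for z
    using continuous_on_compose2[OF f, of "{a..b}" "\<lambda>x. (x, z x)"] that
    by (simp add: continuous_on_Pair image_subset_iff)
  have ex: "\<exists>q v. neumann q v (\<lambda>x. L * q x - (L * z x - f x (z x)))" if "continuous_on {a..b} z" for z
  proof -
    have "continuous_on {a..b} (\<lambda>x. L * z x - f x (z x))"
      by (intro continuous_intros fc that)
    then show ?thesis
      using neumann_resolvent[of "sqrt L" "\<lambda>x. L * z x - f x (z x)"] L by simp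
  qed
  define Q where "Q z = (SOME q. \<exists>v. neumann q v (\<lambda>x. L * q x - (L * z x - f x (z x))))" for z
  have Q: "\<exists>v. neumann (Q z) v (\<lambda>x. L * Q z x - (L * z x - f x (z x)))" if "continuous_on {a..b} z" for z
    unfolding Q_def by (rule someI_ex[OF ex[OF that]])
  have Qc: "continuous_on {a..b} (Q z)" if "continuous_on {a..b} z" for z
    using Q[OF that] neumannD(6) by blast
  define T where "T z = Bcontfun (ext_cont (Q (apply_bcontfun z)) a b)" for z :: "real \<Rightarrow>\<^sub>C real"
  have T: "apply_bcontfun (T z) = ext_cont (Q (apply_bcontfun z)) a b" for z
  proof -
    have c: "continuous_on {a..b} (Q (apply_bcontfun z))" by (intro Qc) auto
    have "ext_cont (Q (apply_bcontfun z)) a b \<in> bcontfun"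
      using c continuous_on_ext_cont[of a b "Q (apply_bcontfun z)" UNIV]
        clamp_bounded[of "Q (apply_bcontfun z)" a b]
        compact_imp_bounded[OF compact_continuous_image[OF c compact_Icc]]
      by (simp add: bcontfun_def ext_cont_def[abs_def])
    then show ?thesis unfolding T_def by (simp add: Bcontfun_inverse)
  qed
  have contr: "dist (T z) (T w) \<le> (1 - m / L) * dist z w" for z w
  proof (rule dist_bound)
    fix x :: real
    let ?x = "clamp a b x"
    have x: "?x \<in> {a..b}" using clamp_in_interval[of a b x] ab by simp
    obtain v v' where "neumann (Q z) v (\<lambda>x. L * Q z x - (L * z x - f x (z x)))"
       "neumann (Q w) v' (\<lambda>x. L * Q w x - (L * w x - f x (w x)))"
      using Q[of "apply_bcontfun z"] Q[of "apply_bcontfun w"] by auto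
    from neumann_diff[OF this]
    have N: "neumann (\<lambda>x. Q z x - Q w x) (\<lambda>x. v x - v' x)
       (\<lambda>x. L * (Q z x - Q w x) + ((f x (z x) - f x (w x)) - L * (z x - w x)))"
      by (rule neumann_cong) (simp add: algebra_simps)
    have "\<bar>Q z ?x - Q w ?x\<bar> \<le> ((L - m) * dist z w) / L"
    proof (rule neumann_linear_bound[OF N L _ _ x])
      fix y assume y: "y \<in> {a..b}"
      have "\<bar>(f y (z y) - f y (w y)) - L * (z y - w y)\<bar> \<le> (L - m) * \<bar>z y - w y\<bar>"
        using slope[OF y, of "z y" "w y"] slope[OF y, of "w y" "z y"] m
        by (cases "z y \<le> w y") (auto simp: algebra_simps)
      also have "\<dots> \<le> (L - m) * dist z w"
        using dist_bounded[of z y w] m by (intro mult_left_mono) (auto simp: dist_real_def)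
      finally show "\<bar>(f y (z y) - f y (w y)) - L * (z y - w y)\<bar> \<le> (L - m) * dist z w" .
    qed simp
    also have "\<dots> = (1 - m / L) * dist z w" using L by (simp add: field_simps)
    finally show "dist (T z x) (T w x) \<le> (1 - m / L) * dist z w"
      by (simp add: T ext_cont_def dist_real_def)
  qed
  have "\<exists>!z. T z = z"
    using contr m L by (intro banach_fix_type[where c="1 - m / L"]) auto
  then obtain z where z: "T z = z" by blast
  then have zQ: "z x = Q z x" if "x \<in> {a..b}" for x
    using T[of z] that by (metis cbox_interval ext_cont_cancel_cbox)
  obtain v where "neumann (Q z) v (\<lambda>x. L * Q z x - (L * z x - f x (z x)))"
    using Q[of "apply_bcontfun z"] by auto
  then have "neumann (Q z) v (\<lambda>x. f x (Q z x))"
    by (rule neumann_cong) (simp add: zQ)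
  then show ?thesis by blast
qed

lemma neumann_linear:
  assumes p: "continuous_on {a..b} p" "\<And>x. x \<in> {a..b} \<Longrightarrow> p x > 0"
    and s: "continuous_on {a..b} s"
  shows "\<exists>q v. neumann q v (\<lambda>x. p x * q x + s x)"
proof -
  obtain x0 where x0: "x0 \<in> {a..b}" "\<And>x. x \<in> {a..b} \<Longrightarrow> p x0 \<le> p x"
    using continuous_attains_inf[of "{a..b}" p] p ab by auto
  obtain x1 where x1: "x1 \<in> {a..b}" "\<And>x. x \<in> {a..b} \<Longrightarrow> p x \<le> p x1"
    using continuous_attains_sup[of "{a..b}" p] p ab by auto
  have c: "continuous_on ({a..b} \<times> UNIV) (\<lambda>z. p (fst z))" "continuous_on ({a..b} \<times> UNIV) (\<lambda>z. s (fst z))"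
    using continuous_on_compose2[OF p(1) continuous_on_fst[OF continuous_on_id], of "{a..b} \<times> UNIV"]
      continuous_on_compose2[OF s continuous_on_fst[OF continuous_on_id], of "{a..b} \<times> UNIV"]
    by auto
  show ?thesis
  proof (rule neumann_semilinear[where m="p x0" and L="p x1"])
    show "continuous_on ({a..b} \<times> UNIV) (\<lambda>(x, z). p x * z + s x)"
      by (auto simp: split_beta intro!: continuous_intros c)
    fix x y z :: real assume "x \<in> {a..b}" "y \<le> z"
    then show "p x0 * (z - y) \<le> (p x * z + s x) - (p x * y + s x) \<and> (p x * z + s x) - (p x * y + s x) \<le> p x1 * (z - y)"
      using x0(2)[of x] x1(2)[of x] mult_right_mono[of "p x0" "p x" "z - y"] mult_right_mono[of "p x" "p x1" "z - y"]
      by (simp add: algebra_simps)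
  qed (use x0 x1 p in auto)
qed

end

section \<open>The singular nonlinearity\<close>

text \<open>The function \<open>\<alpha> / y\<close> is modified outside \<open>[\<epsilon>, M]\<close> so that its slope stays between two negative
  constants, as the contraction argument requires.\<close>
lemma truncated_reciprocal:
  fixes \<alpha> :: real
  assumes "\<alpha> > 0" "0 < \<epsilon>" "\<epsilon> \<le> M"
  obtains F m L where "0 < m" "m \<le> L" "continuous_on UNIV F"
    "\<And>y z. y \<le> z \<Longrightarrow> m * (z - y) \<le> F y - F z \<and> F y - F z \<le> L * (z - y)"
    "\<And>y. \<epsilon> \<le> y \<Longrightarrow> y \<le> M \<Longrightarrow> F y = \<alpha> / y"
proof -
  define c where "c y = max \<epsilon> (min M y)" for y
  define m where "m = \<alpha> / M\<^sup>2"
  define L where "L = \<alpha> / \<epsilon>\<^sup>2"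
  define F where "F y = \<alpha> / c y - m * (y - c y)" for y
  have c_pos: "c y > 0" and c_bounds: "\<epsilon> \<le> c y" "c y \<le> M" for y
    using assms by (auto simp: c_def)
  have "m > 0" using assms by (simp add: m_def)
  moreover have "m \<le> L"
    unfolding m_def L_def using assms by (intro divide_left_mono power_mono mult_pos_pos) auto
  moreover have "continuous_on UNIV F"
    unfolding F_def using c_pos
    by (auto intro!: continuous_intros simp: c_def[abs_def] less_imp_neq[symmetric])
  moreover have "m * (z - y) \<le> F y - F z \<and> F y - F z \<le> L * (z - y)" if yz: "y \<le> z" for y z
  proof -
    have c1: "c y \<le> c z" "c z - c y \<le> z - y" using yz assms by (auto simp: c_def)
    have e: "\<alpha> / c y - \<alpha> / c z = \<alpha> / (c y * c z) * (c z - c y)"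
      using c_pos[of y] c_pos[of z] by (simp add: field_simps)
    have "\<epsilon>\<^sup>2 \<le> c y * c z" "c y * c z \<le> M\<^sup>2"
      unfolding power2_eq_square using c_bounds[of y] c_bounds[of z] assms by (auto intro!: mult_mono)
    then have "m \<le> \<alpha> / (c y * c z)" "\<alpha> / (c y * c z) \<le> L"
      unfolding m_def L_def using assms c_pos[of y] c_pos[of z]
      by (auto intro!: divide_left_mono mult_pos_pos)
    from this[THEN mult_right_mono, of "c z - c y"]
    have "m * (c z - c y) \<le> \<alpha> / c y - \<alpha> / c z" "\<alpha> / c y - \<alpha> / c z \<le> L * (c z - c y)"
      unfolding e using c1 by linarith+
    moreover have "m * ((z - y) - (c z - c y)) \<le> L * ((z - y) - (c z - c y))"
      using \<open>m \<le> L\<close> c1 by (intro mult_right_mono) auto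
    ultimately show ?thesis by (simp add: F_def algebra_simps)
  qed
  moreover have "F y = \<alpha> / y" if "\<epsilon> \<le> y" "y \<le> M" for y
    using that by (simp add: F_def c_def)
  ultimately show ?thesis using that by blast
qed

lemma continuous_on_Icc_bounds:
  fixes f :: "real \<Rightarrow> real"
  assumes "continuous_on {a..b} f"
  obtains B where "B > 0" "\<And>x. x \<in> {a..b} \<Longrightarrow> \<bar>f x\<bar> \<le> B"
  using compact_imp_bounded[OF compact_continuous_image[OF assms compact_Icc]]
  unfolding bounded_pos by auto

lemma continuous_on_Icc_pos:
  fixes f :: "real \<Rightarrow> real"
  assumes "continuous_on {a..b} f" "\<And>x. x \<in> {a..b} \<Longrightarrow> f x > 0"
  obtains m where "m > 0" "\<And>x. x \<in> {a..b} \<Longrightarrow> m \<le> f x"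
proof (cases "{a..b} = {}")
  case True then show ?thesis using that[of 1] by auto
next
  case False
  then show ?thesis
    using continuous_attains_inf[OF compact_Icc False assms(1)] assms(2) that by blast
qed

context weighted_interval
begin

lemma neumann_velocity_limit:
  assumes N: "\<forall>\<^sub>F t in F. neumann (q t) (v t) (r t)" and N0: "neumann q0 v0 r0"
    and r: "uniform_limit {a..b} r r0 F"
  shows "uniform_limit {a..b} v v0 F"
proof (rule uniform_limitI)
  fix e :: real assume "e > 0"
  obtain R where R: "R > 0" "\<And>x. x \<in> {a..b} \<Longrightarrow> \<bar>\<rho> x\<bar> \<le> R"
    using continuous_on_Icc_bounds[OF \<rho>_cont] by blast
  define K where "K = R * (b - a)"
  define d where "d = e / 2 / K"
  have "K > 0" using R(1) ab by (simp add: K_def)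
  then have "d > 0" "K * d = e / 2" using \<open>e > 0\<close> by (simp_all add: d_def)
  then have d: "d > 0" "R * d * (b - a) = e / 2" by (simp_all add: K_def mult.assoc mult.commute[of "b - a"])
  show "\<forall>\<^sub>F t in F. \<forall>x\<in>{a..b}. dist (v t x) (v0 x) < e"
    using N uniform_limitD[OF r d(1)]
  proof eventually_elim
    case (elim t)
    note D = neumann_diff[OF elim(1) N0]
    show ?case
    proof
      fix x assume x: "x \<in> {a..b}"
      show "dist (v t x) (v0 x) < e"
      proof (cases "x = a")
        case True then show ?thesis using neumannD(1)[OF elim(1)] neumannD(1)[OF N0] \<open>e > 0\<close> by simp
      next
        case False
        have "a \<in> {a..b}" using ab by simp
        then obtain \<xi> where \<xi>: "\<xi> \<in> {a..b}"
          "(v t x - v0 x) - (v t a - v0 a) = \<rho> \<xi> * (r t \<xi> - r0 \<xi>) * (x - a)"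
          using mvt_between[where f="\<lambda>x. v t x - v0 x" and f'="\<lambda>x. \<rho> x * (r t x - r0 x)",
              OF neumannD(5)[OF D] _ x] False by metis
        then have "\<bar>v t x - v0 x\<bar> = \<bar>\<rho> \<xi>\<bar> * \<bar>r t \<xi> - r0 \<xi>\<bar> * (x - a)"
          using neumannD(1)[OF D] x by (simp add: abs_mult)
        also have "\<dots> \<le> R * d * (b - a)"
          using R(2)[OF \<xi>(1)] elim(2) \<xi>(1) x R(1) d(1)
          by (intro mult_mono) (auto simp: dist_real_def less_imp_le)
        finally show ?thesis using d \<open>e > 0\<close> by (simp add: dist_real_def)
      qed
    qed
  qed
qed

text \<open>The difference of two solutions solves the equation with the coefficient \<open>p t\<close>, which is
  eventually bounded below, and with a right-hand side tending to zero, so the linear bound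
  applies. Time continuity and time differentiability both follow from this one statement.\<close>
lemma neumann_linear_limit:
  assumes N: "\<forall>\<^sub>F t in F. neumann (q t) (v t) (\<lambda>x. p t x * q t x + s t x)"
    and N0: "neumann q0 v0 (\<lambda>x. p0 x * q0 x + s0 x)"
    and p0: "continuous_on {a..b} p0" "\<And>x. x \<in> {a..b} \<Longrightarrow> p0 x > 0"
    and p: "uniform_limit {a..b} p p0 F" and s: "uniform_limit {a..b} s s0 F"
  shows "uniform_limit {a..b} q q0 F" "uniform_limit {a..b} v v0 F"
proof -
  obtain m where m: "m > 0" "\<And>x. x \<in> {a..b} \<Longrightarrow> m \<le> p0 x"
    using continuous_on_Icc_pos[OF p0] by blast
  obtain B where B: "B > 0" "\<And>x. x \<in> {a..b} \<Longrightarrow> \<bar>q0 x\<bar> \<le> B"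
    using continuous_on_Icc_bounds[OF neumannD(6)[OF N0]] by blast
  show q: "uniform_limit {a..b} q q0 F"
  proof (rule uniform_limitI)
    fix e :: real assume "e > 0"
    define d where "d = min (m / 2) (e * m / (4 * (B + 1)))"
    have d: "d > 0" "d \<le> m / 2" "d * (B + 1) \<le> e * m / 4"
    proof -
      show "d > 0" using m(1) \<open>e > 0\<close> B(1) by (simp add: d_def)
      show "d \<le> m / 2" unfolding d_def by (rule min.cobounded1)
      have "d \<le> e * m / (4 * (B + 1))" by (simp add: d_def)
      then show "d * (B + 1) \<le> e * m / 4" using B by (simp add: field_simps)
    qed
    show "\<forall>\<^sub>F t in F. \<forall>x\<in>{a..b}. dist (q t x) (q0 x) < e"
      using N uniform_limitD[OF p d(1)] uniform_limitD[OF s d(1)]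
    proof eventually_elim
      case (elim t)
      have D: "neumann (\<lambda>x. q t x - q0 x) (\<lambda>x. v t x - v0 x)
          (\<lambda>x. p t x * (q t x - q0 x) + ((p t x - p0 x) * q0 x + (s t x - s0 x)))"
        by (rule neumann_cong[OF neumann_diff[OF elim(1) N0]]) (simp add: algebra_simps)
      show ?case
      proof
        fix x assume x: "x \<in> {a..b}"
        have "\<bar>q t x - q0 x\<bar> \<le> (d * (B + 1)) / (m / 2)"
        proof (rule neumann_linear_bound[OF D _ _ _ x])
          fix y assume y: "y \<in> {a..b}"
          have *: "\<bar>p t y - p0 y\<bar> < d" "\<bar>s t y - s0 y\<bar> < d" using elim y by (auto simp: dist_real_def)
          then show "m / 2 \<le> p t y" using m(2)[OF y] d(2) by linarith
          have "\<bar>(p t y - p0 y) * q0 y\<bar> \<le> d * B"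
            unfolding abs_mult using * B(2)[OF y] d(1) by (intro mult_mono) auto
          then show "\<bar>(p t y - p0 y) * q0 y + (s t y - s0 y)\<bar> \<le> d * (B + 1)"
            using * by (simp add: algebra_simps)
        qed (use m in simp)
        also have "\<dots> \<le> e / 2" using d(3) m(1) by (simp add: field_simps)
        finally show "dist (q t x) (q0 x) < e" using \<open>e > 0\<close> by (simp add: dist_real_def)
      qed
    qed
  qed
  have bd: "bounded (p0 ` {a..b})" "bounded (q0 ` {a..b})"
    by (intro compact_imp_bounded compact_continuous_image p0 neumannD(6)[OF N0] compact_Icc)+
  have "uniform_limit {a..b} (\<lambda>t x. p t x * q t x + s t x) (\<lambda>x. p0 x * q0 x + s0 x) F"
    by (intro uniform_limit_add uniform_lim_mult p q s bd)
  from neumann_velocity_limit[OF N N0 this] show "uniform_limit {a..b} v v0 F" .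
qed

text \<open>The solution of the truncated problem solves the original one once its argument
  \<open>Y = y0 + g - q\<close> is known to stay in \<open>[\<epsilon>, M]\<close>. The upper bound comes from the maximum principle.
  For the lower bound, \<open>\<Phi>\<close> with \<open>\<Phi>' = \<rho> F(Y)\<close> increases by \<open>C\<close> in total, which also bounds \<open>v\<close> and
  hence a Lipschitz constant \<open>L\<close> of \<open>Y\<close> independently of \<open>\<epsilon>\<close>. A value of \<open>Y\<close> below
  \<open>\<epsilon>\<close> would force an increase of \<open>\<Phi>\<close> of order \<open>ln (1 + L l / \<epsilon>)\<close> over a half interval of length
  \<open>l\<close>, more than \<open>C\<close>.\<close>
lemma neumann_singular:
  fixes \<alpha> :: real
  assumes "\<alpha> > 0"
    and y0: "\<And>x. x \<in> {a..b} \<Longrightarrow> y0 x > 0" "L0-lipschitz_on {a..b} y0"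
    and g: "\<And>x. x \<in> {a..b} \<Longrightarrow> \<bar>g x\<bar> \<le> H" "L1-lipschitz_on {a..b} g"
  shows "\<exists>q v. neumann q v (\<lambda>x. \<alpha> / (y0 x + g x - q x) - \<alpha> / y0 x) \<and>
           (\<forall>x\<in>{a..b}. y0 x + g x - q x > 0)"
proof -
  have cont: "continuous_on {a..b} y0" "continuous_on {a..b} g"
    using y0 g lipschitz_on_continuous_on by blast+
  obtain ymin where ymin: "ymin > 0" "\<And>x. x \<in> {a..b} \<Longrightarrow> ymin \<le> y0 x"
    using continuous_on_Icc_pos[OF cont(1) y0(1)] by blast
  obtain ymax where ymax: "ymax > 0" "\<And>x. x \<in> {a..b} \<Longrightarrow> \<bar>y0 x\<bar> \<le> ymax"
    using continuous_on_Icc_bounds[OF cont(1)] by blast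
  obtain rmin where rmin: "rmin > 0" "\<And>x. x \<in> {a..b} \<Longrightarrow> rmin \<le> \<rho> x"
    using continuous_on_Icc_pos[OF \<rho>_cont \<rho>_pos] by blast
  obtain R where R: "R > 0" "\<And>x. x \<in> {a..b} \<Longrightarrow> \<bar>\<rho> x\<bar> \<le> R"
    using continuous_on_Icc_bounds[OF \<rho>_cont] by blast
  have aI: "a \<in> {a..b}" and bI: "b \<in> {a..b}" using ab by auto
  have H: "H \<ge> 0" using g(1)[OF aI] by linarith
  have L01: "L0 \<ge> 0" "L1 \<ge> 0" using y0(2) g(2) lipschitz_on_nonneg by blast+
  have inv_cont: "continuous_on {a..b} (\<lambda>x. \<alpha> / y0 x)"
    using y0(1) by (intro continuous_intros cont) force
  obtain W where W: "W a = 0"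
    "\<And>x. x \<in> {a..b} \<Longrightarrow> (W has_real_derivative \<rho> x * (\<alpha> / y0 x)) (at x within {a..b})"
    using integral_antiderivative[OF continuous_on_mult[OF \<rho>_cont inv_cont]] by blast
  have mono: "f x \<le> f z" if der: "\<And>x. x \<in> {a..b} \<Longrightarrow> (f has_real_derivative f' x) (at x within {a..b})"
    and nn: "\<And>x. x \<in> {a..b} \<Longrightarrow> f' x \<ge> 0" and xz: "x \<in> {a..b}" "z \<in> {a..b}" "x \<le> z" for f f' x z
  proof (cases "x = z")
    case False
    with mvt_between[of a b f f' x z, OF der xz(1,2)] obtain \<xi> where
      "\<xi> \<in> {a..b}" "f z - f x = f' \<xi> * (z - x)" by blast
    then show ?thesis using nn xz(3) by (metis diff_ge_0_iff_ge mult_nonneg_nonneg)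
  qed simp
  define C where "C = W b"
  have WC: "0 \<le> W x" "W x \<le> C" if x: "x \<in> {a..b}" for x
    using mono[OF W(2) _ aI x] mono[OF W(2) _ x bI] W(1) x \<open>\<alpha> > 0\<close> y0(1) \<rho>_pos
    by (auto simp: C_def less_imp_le)
  then have C: "C \<ge> 0" using W(1) aI by force
  define L where "L = L0 + L1 + R * C + 1"
  have L: "L > 0" using L01 R C by (simp add: L_def add_nonneg_pos)
  define l where "l = (b - a) / 2"
  have l: "l > 0" using ab by (simp add: l_def)
  \<comment> \<open>Small enough that \<open>\<integral> \<alpha> \<rho> / (\<epsilon> + L s) ds\<close> over a half interval exceeds the available mass \<open>C\<close>.\<close>
  define \<epsilon> where "\<epsilon> = min ymin (L * l / exp (C * L / (rmin * \<alpha>)))"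
  have \<epsilon>: "\<epsilon> > 0" "\<epsilon> \<le> ymin" using ymin L l by (auto simp: \<epsilon>_def)
  have \<epsilon>_ln: "rmin * \<alpha> / L * (ln (\<epsilon> + L * l) - ln \<epsilon>) > C"
  proof -
    have "\<epsilon> \<le> L * l / exp (C * L / (rmin * \<alpha>))" by (simp add: \<epsilon>_def)
    then have "exp (C * L / (rmin * \<alpha>)) * \<epsilon> \<le> L * l" by (simp add: field_simps)
    then have "exp (C * L / (rmin * \<alpha>)) * \<epsilon> < \<epsilon> + L * l" using \<epsilon>(1) by linarith
    then have "ln (exp (C * L / (rmin * \<alpha>)) * \<epsilon>) < ln (\<epsilon> + L * l)"
      using \<epsilon>(1) L l by (subst ln_less_cancel_iff) (auto intro!: add_pos_pos)
    then have "C * L / (rmin * \<alpha>) < ln (\<epsilon> + L * l) - ln \<epsilon>"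
      using \<epsilon>(1) by (simp add: ln_mult)
    then show ?thesis using L rmin(1) \<open>\<alpha> > 0\<close> by (simp add: field_simps)
  qed
  define M where "M = ymax + 2 * H"
  have M: "\<epsilon> \<le> M" "\<And>x. x \<in> {a..b} \<Longrightarrow> y0 x + 2 * H \<le> M"
  proof -
    show "\<epsilon> \<le> M" using \<epsilon>(2) ymin(2)[OF aI] ymax(2)[OF aI] H by (simp add: M_def)
    show "y0 x + 2 * H \<le> M" if "x \<in> {a..b}" for x using ymax(2)[OF that] by (simp add: M_def)
  qed
  obtain F m K where F: "0 < m" "m \<le> K" "continuous_on UNIV F"
    "\<And>y z. y \<le> z \<Longrightarrow> m * (z - y) \<le> F y - F z \<and> F y - F z \<le> K * (z - y)"
    "\<And>y. \<epsilon> \<le> y \<Longrightarrow> y \<le> M \<Longrightarrow> F y = \<alpha> / y"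
    by (rule truncated_reciprocal[OF \<open>\<alpha> > 0\<close> \<epsilon>(1) M(1)], rule that; assumption)
  have F_anti: "F z \<le> F y" if "y \<le> z" for y z
    using F(4)[OF that] mult_nonneg_nonneg[of m "z - y"] F(1) that by linarith
  have F_less: "F z < F y" if "y < z" for y z
    using F(4)[of y z] mult_pos_pos[OF F(1), of "z - y"] that by linarith
  have Fy0: "F (y0 x) = \<alpha> / y0 x" if "x \<in> {a..b}" for x
    using F(5)[of "y0 x"] \<epsilon>(2) ymin(2)[OF that] M(2)[OF that] H by linarith
  define f where "f x z = F (y0 x + g x - z) - \<alpha> / y0 x" for x z
  have "\<exists>q v. neumann q v (\<lambda>x. f x (q x))"
  proof (rule neumann_semilinear[OF F(1,2)])
    have fst: "continuous_on ({a..b} \<times> UNIV) (\<lambda>z. k (fst z))" if "continuous_on {a..b} k"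
      for k :: "real \<Rightarrow> real"
      using continuous_on_compose2[OF that continuous_on_fst[OF continuous_on_id], of "{a..b} \<times> UNIV"] by auto
    show "continuous_on ({a..b} \<times> UNIV) (\<lambda>(x, z). f x z)"
      unfolding f_def split_beta
      by (intro continuous_on_diff continuous_on_compose2[OF F(3)] continuous_on_add fst cont inv_cont
          continuous_on_snd continuous_on_id) auto
    fix x y z :: real assume "y \<le> z"
    then show "m * (z - y) \<le> f x z - f x y \<and> f x z - f x y \<le> K * (z - y)"
      using F(4)[of "y0 x + g x - z" "y0 x + g x - y"] by (simp add: f_def)
  qed
  then obtain q v where N: "neumann q v (\<lambda>x. f x (q x))" by blast
  define Y where "Y x = y0 x + g x - q x" for x
  have f: "f x (q x) = F (Y x) - \<alpha> / y0 x" for x by (simp add: f_def Y_def)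
  have q_le: "q x \<le> H" if "x \<in> {a..b}" for x
  proof (rule neumann_max[OF N _ that])
    fix x assume x: "x \<in> {a..b}" "q x > H"
    then have "Y x < y0 x" using g(1)[OF x(1)] by (auto simp: Y_def)
    from F_less[OF this] show "f x (q x) > 0" using Fy0[OF x(1)] by (simp add: f)
  qed
  have q_ge: "q x \<ge> - H" if "x \<in> {a..b}" for x
  proof (rule neumann_min[OF N _ that])
    fix x assume x: "x \<in> {a..b}" "q x < - H"
    then have "Y x > y0 x" using g(1)[OF x(1)] by (auto simp: Y_def)
    from F_less[OF this] show "f x (q x) < 0" using Fy0[OF x(1)] by (simp add: f)
  qed
  have YM: "Y x \<le> M" if "x \<in> {a..b}" for x
    using M(2)[OF that] q_ge[OF that] g(1)[OF that] by (simp add: Y_def abs_le_iff)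
  have F_nn: "F (Y x) \<ge> 0" if "x \<in> {a..b}" for x
  proof -
    have "F M \<ge> 0" using F(5)[of M] M(1) \<epsilon>(1) \<open>\<alpha> > 0\<close> by simp
    then show ?thesis using F_anti[OF YM[OF that]] by linarith
  qed
  define \<Phi> where "\<Phi> x = v x + W x" for x
  have \<Phi>': "(\<Phi> has_real_derivative \<rho> x * F (Y x)) (at x within {a..b})" if x: "x \<in> {a..b}" for x
    unfolding \<Phi>_def using DERIV_add[OF neumannD(5)[OF N x] W(2)[OF x]]
    by (rule DERIV_cong) (simp add: f algebra_simps)
  have \<Phi>C: "0 \<le> \<Phi> x" "\<Phi> x \<le> C" if x: "x \<in> {a..b}" for x
    using mono[OF \<Phi>' _ aI x] mono[OF \<Phi>' _ x bI] neumannD(1,2)[OF N] W(1) x F_nn \<rho>_pos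
    by (auto simp: \<Phi>_def C_def less_imp_le)
  have Y_lip: "Y x \<le> Y z + L * \<bar>x - z\<bar>" if xz: "x \<in> {a..b}" "z \<in> {a..b}" for x z
  proof (cases "x = z")
    case False
    then obtain \<xi> where \<xi>: "\<xi> \<in> {a..b}" "q x - q z = \<rho> \<xi> * v \<xi> * (x - z)"
      using mvt_between[where f=q and f'="\<lambda>x. \<rho> x * v x", OF neumannD(4)[OF N] xz(2,1)] by metis
    have "\<bar>v \<xi>\<bar> \<le> C" using \<Phi>C[OF \<xi>(1)] WC[OF \<xi>(1)] by (simp add: \<Phi>_def abs_le_iff)
    then have "\<bar>q x - q z\<bar> \<le> R * C * \<bar>x - z\<bar>"
      unfolding \<xi>(2) abs_mult using R(2)[OF \<xi>(1)] C R(1) by (intro mult_mono) auto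
    moreover have "\<bar>y0 x - y0 z\<bar> \<le> L0 * \<bar>x - z\<bar>" "\<bar>g x - g z\<bar> \<le> L1 * \<bar>x - z\<bar>"
      using lipschitz_onD[OF y0(2) xz] lipschitz_onD[OF g(2) xz] by (auto simp: dist_real_def)
    moreover have "L * \<bar>x - z\<bar> = L0 * \<bar>x - z\<bar> + L1 * \<bar>x - z\<bar> + R * C * \<bar>x - z\<bar> + \<bar>x - z\<bar>"
      by (simp add: L_def algebra_simps)
    ultimately show ?thesis unfolding Y_def by linarith
  qed simp
  have Y_ge: "Y x \<ge> \<epsilon>" if x0: "x \<in> {a..b}" for x
  proof (rule ccontr)
    assume "\<not> \<epsilon> \<le> Y x"
    then have Yx: "Y x < \<epsilon>" by simp
    have FY: "F (Y z) \<ge> \<alpha> / (\<epsilon> + L * \<bar>z - x\<bar>)" if z: "z \<in> {a..b}" for z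
    proof -
      have Yz: "Y z \<le> \<epsilon> + L * \<bar>z - x\<bar>" using Y_lip[OF z x0] Yx by linarith
      have pos: "0 \<le> L * \<bar>z - x\<bar>" using L by simp
      show ?thesis
      proof (cases "Y z \<le> \<epsilon>")
        case True
        have "\<alpha> / (\<epsilon> + L * \<bar>z - x\<bar>) \<le> \<alpha> / \<epsilon>"
          using \<epsilon>(1) \<open>\<alpha> > 0\<close> pos by (intro divide_left_mono) (auto intro!: mult_pos_pos add_pos_nonneg)
        then show ?thesis using F_anti[OF True] F(5)[of \<epsilon>] M(1) by simp
      next
        case False
        have "\<alpha> / (\<epsilon> + L * \<bar>z - x\<bar>) \<le> \<alpha> / Y z"
          using \<epsilon>(1) \<open>\<alpha> > 0\<close> pos Yz False
          by (intro divide_left_mono) (auto intro!: mult_pos_pos add_pos_nonneg)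
        then show ?thesis using F(5)[of "Y z"] False YM[OF z] by simp
      qed
    qed
    \<comment> \<open>\<open>\<sigma>\<close> points to the side of \<open>x\<close> on which half of the interval is available.\<close>
    define \<sigma> :: real where "\<sigma> = (if x + l \<le> b then 1 else - 1)"
    have \<sigma>: "\<sigma> = 1 \<or> \<sigma> = - 1" "\<sigma> * \<sigma> = 1" by (auto simp: \<sigma>_def)
    define x1 where "x1 = x + \<sigma> * l"
    have x1: "x1 \<in> {a..b}" using x0 l by (auto simp: x1_def \<sigma>_def l_def field_simps)
    \<comment> \<open>On \<open>[c, d]\<close> the distance to \<open>x\<close> is \<open>\<sigma> * (z - x)\<close>, which is differentiable up to the endpoint \<open>x\<close>.\<close>
    define c d where "c = min x x1" and "d = max x x1"
    have cd: "x \<in> {c..d}" "x1 \<in> {c..d}" "{c..d} \<subseteq> {a..b}" using x0 x1 by (auto simp: c_def d_def)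
    have "x \<noteq> x1" using l \<sigma> by (auto simp: x1_def)
    have side: "\<sigma> * (z - x) = \<bar>z - x\<bar>" if "z \<in> {c..d}" for z
      using that l by (auto simp: c_def d_def x1_def \<sigma>_def split: if_splits)
    define G where "G z = \<sigma> * \<Phi> z - rmin * \<alpha> / L * ln (\<epsilon> + L * (\<sigma> * (z - x)))" for z
    have G': "(G has_real_derivative \<sigma> * (\<rho> z * F (Y z) - rmin * \<alpha> / (\<epsilon> + L * (\<sigma> * (z - x))))) (at z within {c..d})"
      if z: "z \<in> {c..d}" for z
    proof -
      have pos: "\<epsilon> + L * (\<sigma> * (z - x)) > 0" unfolding side[OF z] using \<epsilon>(1) L by (simp add: add_pos_nonneg)
      have "z \<in> {a..b}" using z cd by blast
      from DERIV_subset[OF \<Phi>'[OF this] cd(3)]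
      have 1: "(\<Phi> has_real_derivative \<rho> z * F (Y z)) (at z within {c..d})" .
      have 2: "((\<lambda>z. \<epsilon> + L * (\<sigma> * (z - x))) has_real_derivative L * \<sigma>) (at z within {c..d})"
        by (auto intro!: derivative_eq_intros)
      have "((\<lambda>z. ln (\<epsilon> + L * (\<sigma> * (z - x)))) has_real_derivative L * \<sigma> / (\<epsilon> + L * (\<sigma> * (z - x)))) (at z within {c..d})"
        using DERIV_chain2[OF DERIV_ln[OF pos] 2] pos by (simp add: divide_inverse mult.commute)
      from DERIV_diff[OF DERIV_cmult[OF 1, of \<sigma>] DERIV_cmult[OF this, of "rmin * \<alpha> / L"]]
      show ?thesis unfolding G_def
        by (rule DERIV_cong) (use L pos in \<open>simp add: field_simps\<close>)
    qed
    obtain \<xi> where \<xi>: "\<xi> \<in> {c..d}"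
      "G x1 - G x = \<sigma> * (\<rho> \<xi> * F (Y \<xi>) - rmin * \<alpha> / (\<epsilon> + L * (\<sigma> * (\<xi> - x)))) * (x1 - x)"
      using mvt_between[OF G' cd(1,2) \<open>x \<noteq> x1\<close>] by blast
    have \<xi>I: "\<xi> \<in> {a..b}" using \<xi>(1) cd by blast
    have "rmin * (\<alpha> / (\<epsilon> + L * \<bar>\<xi> - x\<bar>)) \<le> \<rho> \<xi> * F (Y \<xi>)"
      using rmin FY[OF \<xi>I] \<rho>_pos[OF \<xi>I] \<epsilon>(1) L \<open>\<alpha> > 0\<close> \<xi>I
      by (intro mult_mono) (auto simp: less_imp_le intro!: divide_nonneg_nonneg add_nonneg_nonneg)
    moreover have "G x1 - G x = (\<sigma> * \<sigma>) * l * (\<rho> \<xi> * F (Y \<xi>) - rmin * (\<alpha> / (\<epsilon> + L * \<bar>\<xi> - x\<bar>)))"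
      unfolding \<xi>(2) side[OF \<xi>(1)] by (simp add: x1_def)
    ultimately have "G x1 - G x \<ge> 0" using l \<sigma>(2) by simp
    moreover have "\<sigma> * (x1 - x) = l" using \<sigma>(1) by (auto simp: x1_def)
    ultimately have "rmin * \<alpha> / L * (ln (\<epsilon> + L * l) - ln \<epsilon>) \<le> \<sigma> * (\<Phi> x1 - \<Phi> x)"
      unfolding G_def by (simp add: algebra_simps)
    also have "\<dots> \<le> C" using \<sigma>(1) \<Phi>C[OF x1] \<Phi>C[OF x0] by auto
    finally show False using \<epsilon>_ln by simp
  qed
  have "neumann q v (\<lambda>x. \<alpha> / (y0 x + g x - q x) - \<alpha> / y0 x)"
    by (rule neumann_cong[OF N]) (use F(5) Y_ge YM in \<open>simp add: f Y_def\<close>)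
  moreover have "\<forall>x\<in>{a..b}. y0 x + g x - q x > 0"
    using Y_ge \<epsilon>(1) by (force simp: Y_def)
  ultimately show ?thesis by blast
qed

end

section \<open>Dependence on time\<close>

definition jcont :: "real \<Rightarrow> real \<Rightarrow> (real \<Rightarrow> real \<Rightarrow> real) \<Rightarrow> bool" where
  "jcont a b \<gamma> \<longleftrightarrow> continuous_on ({0..} \<times> {a..b}) (\<lambda>z. \<gamma> (fst z) (snd z))"

definition time_deriv :: "real \<Rightarrow> real \<Rightarrow> (real \<Rightarrow> real \<Rightarrow> real) \<Rightarrow> (real \<Rightarrow> real \<Rightarrow> real) \<Rightarrow> bool" where
  "time_deriv a b \<gamma> \<gamma>' \<longleftrightarrow>
     (\<forall>t\<ge>0. \<forall>x\<in>{a..b}. ((\<lambda>s. \<gamma> s x) has_real_derivative \<gamma>' t x) (at t within {0..}))"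

lemma nonneg_choice2:
  assumes "\<And>t::real. t \<ge> 0 \<Longrightarrow> \<exists>q v. P t q v"
  obtains q v where "\<And>t. t \<ge> 0 \<Longrightarrow> P t (q t) (v t)"
  using assms by metis

lemma jcont_time [intro]: "jcont a b (\<lambda>t x. t)"
  unfolding jcont_def by (intro continuous_intros)

lemma jcont_space [intro]: "continuous_on {a..b} f \<Longrightarrow> jcont a b (\<lambda>t x. f x)"
  unfolding jcont_def
  by (erule continuous_on_compose2[OF _ continuous_on_snd[OF continuous_on_id]]) auto

lemma jcont_add [intro]: "jcont a b f \<Longrightarrow> jcont a b g \<Longrightarrow> jcont a b (\<lambda>t x. f t x + g t x)"
  and jcont_diff [intro]: "jcont a b f \<Longrightarrow> jcont a b g \<Longrightarrow> jcont a b (\<lambda>t x. f t x - g t x)"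
  and jcont_mult [intro]: "jcont a b f \<Longrightarrow> jcont a b g \<Longrightarrow> jcont a b (\<lambda>t x. f t x * g t x)"
  and jcont_minus [intro]: "jcont a b f \<Longrightarrow> jcont a b (\<lambda>t x. - f t x)"
  and jcont_power [intro]: "jcont a b f \<Longrightarrow> jcont a b (\<lambda>t x. f t x ^ n)"
  unfolding jcont_def by (intro continuous_intros; assumption)+

lemma jcont_divide [intro]:
  "jcont a b f \<Longrightarrow> jcont a b g \<Longrightarrow> (\<And>t x. 0 \<le> t \<Longrightarrow> x \<in> {a..b} \<Longrightarrow> g t x \<noteq> 0) \<Longrightarrow>
    jcont a b (\<lambda>t x. f t x / g t x)"
  unfolding jcont_def by (intro continuous_on_divide) auto

lemma jcont_slice:
  assumes "jcont a b \<gamma>" "t \<ge> 0"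
  shows "continuous_on {a..b} (\<gamma> t)"
  using continuous_on_compose2[OF assms(1)[unfolded jcont_def], of "{a..b}" "\<lambda>x. (t, x)"] assms(2)
  by (simp add: continuous_on_Pair image_subset_iff)

lemma jcont_uniform_limit:
  assumes "jcont a b \<gamma>" "t \<ge> 0"
  shows "uniform_limit {a..b} \<gamma> (\<gamma> t) (at t within {0..})"
proof (rule uniform_limitI)
  fix e :: real assume "e > 0"
  then have "e / 2 > 0" by simp
  have tU: "t \<in> {0..}" using assms(2) by simp
  show "\<forall>\<^sub>F s in at t within {0..}. \<forall>x\<in>{a..b}. dist (\<gamma> s x) (\<gamma> t x) < e"
  proof (rule continuous_on_prod_compactE[OF assms(1)[unfolded jcont_def] compact_Icc tU \<open>e / 2 > 0\<close>])
    fix X assume X: "t \<in> X" "open X"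
      "\<forall>s\<in>X \<inter> {0..}. \<forall>x\<in>{a..b}. dist (\<gamma> (fst (s, x)) (snd (s, x))) (\<gamma> (fst (t, x)) (snd (t, x))) \<le> e / 2"
    from X(1,2) have "\<forall>\<^sub>F s in at t within {0..}. s \<in> X \<inter> {0..}"
      unfolding eventually_at_topological by blast
    then show ?thesis
    proof eventually_elim
      case (elim s)
      with X(3) \<open>e > 0\<close> show ?case by force
    qed
  qed
qed

lemma uniform_limit_jcont:
  assumes lim: "\<And>t. t \<ge> 0 \<Longrightarrow> uniform_limit {a..b} \<gamma> (\<gamma> t) (at t within {0..})"
    and cont: "\<And>t. t \<ge> 0 \<Longrightarrow> continuous_on {a..b} (\<gamma> t)"
  shows "jcont a b \<gamma>"
  unfolding jcont_def continuous_on_iff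
proof (intro ballI allI impI)
  fix z :: "real \<times> real" and e :: real assume z: "z \<in> {0..} \<times> {a..b}" and "e > 0"
  obtain t x where tx: "z = (t, x)" "t \<ge> 0" "x \<in> {a..b}" using z by auto
  have "\<forall>\<^sub>F s in at t within {0..}. \<forall>y\<in>{a..b}. dist (\<gamma> s y) (\<gamma> t y) < e / 2"
    using uniform_limitD[OF lim[OF tx(2)], of "e / 2"] \<open>e > 0\<close> by simp
  then obtain d1 where d1: "d1 > 0"
    "\<forall>s\<in>{0..}. s \<noteq> t \<and> dist s t < d1 \<longrightarrow> (\<forall>y\<in>{a..b}. dist (\<gamma> s y) (\<gamma> t y) < e / 2)"
    unfolding eventually_at by blast
  have near: "dist (\<gamma> s y) (\<gamma> t y) < e / 2" if "s \<ge> 0" "dist s t < d1" "y \<in> {a..b}" for s y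
    using d1(2) that \<open>e > 0\<close> by (cases "s = t") auto
  have "e / 2 > 0" using \<open>e > 0\<close> by simp
  then obtain d2 where d2: "d2 > 0"
    "\<And>y. y \<in> {a..b} \<Longrightarrow> dist y x < d2 \<Longrightarrow> dist (\<gamma> t y) (\<gamma> t x) < e / 2"
    using cont[OF tx(2)] tx(3) unfolding continuous_on_iff by blast
  show "\<exists>d>0. \<forall>w\<in>{0..} \<times> {a..b}. dist w z < d \<longrightarrow>
      dist (\<gamma> (fst w) (snd w)) (\<gamma> (fst z) (snd z)) < e"
  proof (intro exI[of _ "min d1 d2"] conjI ballI impI)
    fix w assume w: "w \<in> {0..} \<times> {a..b}" "dist w z < min d1 d2"
    then have "dist (fst w) t < d1" "dist (snd w) x < d2"
      using dist_fst_le[of w z] dist_snd_le[of w z] tx(1) by auto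
    then have "dist (\<gamma> (fst w) (snd w)) (\<gamma> t (snd w)) < e / 2" "dist (\<gamma> t (snd w)) (\<gamma> t x) < e / 2"
      using w(1) near d2(2) by auto
    then show "dist (\<gamma> (fst w) (snd w)) (\<gamma> (fst z) (snd z)) < e"
      using dist_triangle_half_l[of "\<gamma> (fst w) (snd w)" "\<gamma> t (snd w)" e "\<gamma> t x"] tx(1)
      by (simp add: dist_commute)
  qed (use d1 d2 in simp)
qed

text \<open>By the mean value theorem the difference quotient at \<open>x\<close> is a value of \<open>\<gamma>'\<close> at a nearby time
  and the same \<open>x\<close>, and a jointly continuous function converges uniformly over a compact
  interval.\<close>
lemma time_deriv_uniform:
  assumes der: "time_deriv a b \<gamma> \<gamma>'" and cont: "jcont a b \<gamma>'" and "t \<ge> 0"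
  shows "uniform_limit {a..b} (\<lambda>s x. (\<gamma> s x - \<gamma> t x) / (s - t)) (\<gamma>' t) (at t within {0..})"
proof (rule uniform_limitI)
  fix e :: real assume "e > 0"
  from uniform_limitD[OF jcont_uniform_limit[OF cont \<open>t \<ge> 0\<close>] this]
  obtain d where d: "d > 0"
    "\<forall>s\<in>{0..}. s \<noteq> t \<and> dist s t < d \<longrightarrow> (\<forall>y\<in>{a..b}. dist (\<gamma>' s y) (\<gamma>' t y) < e)"
    unfolding eventually_at by blast
  have "dist ((\<gamma> s x - \<gamma> t x) / (s - t)) (\<gamma>' t x) < e"
    if s: "s \<in> {0..}" "s \<noteq> t" "dist s t < d" and x: "x \<in> {a..b}" for s x
  proof -
    have "((\<lambda>s. \<gamma> s x) has_real_derivative \<gamma>' r x) (at r within {0..max s t})" if "r \<in> {0..max s t}" for r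
      by (rule DERIV_subset[of _ _ r "{0..}"]) (use der that x in \<open>auto simp: time_deriv_def\<close>)
    then obtain \<xi> where \<xi>: "\<xi> \<in> {0..max s t}" "\<gamma> s x - \<gamma> t x = \<gamma>' \<xi> x * (s - t)"
      "\<bar>\<xi> - t\<bar> < \<bar>s - t\<bar>" "(\<xi> - t) * (s - t) > 0"
      using mvt_between[of 0 "max s t" "\<lambda>s. \<gamma> s x" "\<lambda>s. \<gamma>' s x" t s] s \<open>t \<ge> 0\<close> by auto
    have "\<xi> \<noteq> t" using \<xi>(4) by auto
    then have "dist (\<gamma>' \<xi> x) (\<gamma>' t x) < e"
      using d(2) \<xi>(1,3) s(3) x by (auto simp: dist_real_def)
    then show ?thesis using \<xi>(2) s(2) by simp
  qed
  then show "\<forall>\<^sub>F s in at t within {0..}. \<forall>x\<in>{a..b}. dist ((\<gamma> s x - \<gamma> t x) / (s - t)) (\<gamma>' t x) < e"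
    unfolding eventually_at using d(1) by blast
qed

lemma uniform_time_deriv:
  assumes "\<And>t. t \<ge> 0 \<Longrightarrow>
    uniform_limit {a..b} (\<lambda>s x. (\<gamma> s x - \<gamma> t x) / (s - t)) (\<gamma>' t) (at t within {0..})"
  shows "time_deriv a b \<gamma> \<gamma>'"
  unfolding time_deriv_def has_field_derivative_iff
  using tendsto_uniform_limitI[OF assms] by blast

context weighted_interval
begin

lemma neumann_divide:
  assumes "neumann q v r"
  shows "neumann (\<lambda>x. q x / c) (\<lambda>x. v x / c) (\<lambda>x. r x / c)"
  using neumann_cmult[OF assms, of "1 / c"] by simp

lemma neumann_velocity_unique:
  assumes N: "neumann q v r" "neumann q' v' r'" and r: "\<And>x. x \<in> {a..b} \<Longrightarrow> r x = r' x"
    and x: "x \<in> {a..b}"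
  shows "v x = v' x"
proof (cases "x = a")
  case True then show ?thesis using neumannD(1)[OF N(1)] neumannD(1)[OF N(2)] by simp
next
  case False
  have "a \<in> {a..b}" using ab by simp
  then obtain \<xi> where "\<xi> \<in> {a..b}"
    "(v x - v' x) - (v a - v' a) = \<rho> \<xi> * (r \<xi> - r' \<xi>) * (x - a)"
    using mvt_between[where f="\<lambda>x. v x - v' x" and f'="\<lambda>x. \<rho> x * (r x - r' x)",
        OF neumannD(5)[OF neumann_diff[OF N]] _ x] False by metis
  then show ?thesis using r neumannD(1)[OF N(1)] neumannD(1)[OF N(2)] by simp
qed

lemma neumann_linear_unique:
  assumes N: "neumann q v (\<lambda>x. p x * q x + s x)" "neumann q' v' (\<lambda>x. p x * q' x + s x)"
    and p: "continuous_on {a..b} p" "\<And>x. x \<in> {a..b} \<Longrightarrow> p x > 0"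
    and x: "x \<in> {a..b}"
  shows "q x = q' x" "v x = v' x"
proof -
  obtain m where m: "m > 0" "\<And>x. x \<in> {a..b} \<Longrightarrow> m \<le> p x"
    using continuous_on_Icc_pos[OF p] by blast
  have D: "neumann (\<lambda>x. q x - q' x) (\<lambda>x. v x - v' x) (\<lambda>x. p x * (q x - q' x) + 0)"
    by (rule neumann_cong[OF neumann_diff[OF N]]) (simp add: algebra_simps)
  have q: "q x = q' x" if "x \<in> {a..b}" for x
    using neumann_linear_bound[OF D m(1) m(2) _ that, of 0] by simp
  then show "q x = q' x" using x by blast
  show "v x = v' x" by (rule neumann_velocity_unique[OF N _ x]) (simp add: q)
qed

lemma neumann_linear_evolution:
  assumes p: "jcont a b p" "\<And>t x. t \<ge> 0 \<Longrightarrow> x \<in> {a..b} \<Longrightarrow> p t x > 0"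
    and s: "jcont a b s"
  obtains q v where "\<And>t. t \<ge> 0 \<Longrightarrow> neumann (q t) (v t) (\<lambda>x. p t x * q t x + s t x)"
    "jcont a b q" "jcont a b v"
proof -
  have ex: "\<exists>q v. neumann q v (\<lambda>x. p t x * q x + s t x)" if "t \<ge> 0" for t
    by (intro neumann_linear jcont_slice[OF _ that] p s that)
  obtain q v where N: "\<And>t. t \<ge> 0 \<Longrightarrow> neumann (q t) (v t) (\<lambda>x. p t x * q t x + s t x)"
    by (rule nonneg_choice2[of "\<lambda>t q v. neumann q v (\<lambda>x. p t x * q x + s t x)", OF ex], assumption, rule that)
  have ev: "\<forall>\<^sub>F r in at t within {0..}. neumann (q r) (v r) (\<lambda>x. p r x * q r x + s r x)" for t
    unfolding eventually_at_filter using N by (auto intro!: always_eventually)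
  have lim: "uniform_limit {a..b} q (q t) (at t within {0..})"
    "uniform_limit {a..b} v (v t) (at t within {0..})" if t: "t \<ge> 0" for t
    by (rule neumann_linear_limit[OF ev N[OF t] jcont_slice[OF p(1) t] p(2)[OF t]
        jcont_uniform_limit[OF p(1) t] jcont_uniform_limit[OF s t]]; assumption)+
  show ?thesis
    by (rule that[OF N uniform_limit_jcont[OF lim(1) neumannD(6)[OF N]]
          uniform_limit_jcont[OF lim(2) neumannD(7)[OF N]]])
qed

lemma neumann_velocity_jcont:
  assumes N: "\<And>t. t \<ge> 0 \<Longrightarrow> neumann (q t) (v t) (r t)" and r: "jcont a b r"
  shows "jcont a b v"
proof (rule uniform_limit_jcont)
  fix t :: real assume t: "t \<ge> 0"
  have ev: "\<forall>\<^sub>F s in at t within {0..}. neumann (q s) (v s) (r s)"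
    unfolding eventually_at_filter using N by (auto intro!: always_eventually)
  show "uniform_limit {a..b} v (v t) (at t within {0..})"
    by (rule neumann_velocity_limit[OF ev N[OF t] jcont_uniform_limit[OF r t]])
  show "continuous_on {a..b} (v t)" using neumannD(7)[OF N[OF t]] .
qed

text \<open>Here \<open>P t s\<close> and \<open>S t s\<close> are the coefficients of the equation satisfied by the difference quotient
  between the times \<open>s\<close> and \<open>t\<close>; the claimed derivative solves the limiting equation.\<close>
lemma neumann_time_deriv:
  assumes dq: "\<And>s t. s \<ge> 0 \<Longrightarrow> t \<ge> 0 \<Longrightarrow> s \<noteq> t \<Longrightarrow>
      neumann (\<lambda>x. (q s x - q t x) / (s - t)) (\<lambda>x. (v s x - v t x) / (s - t))
        (\<lambda>x. P t s x * ((q s x - q t x) / (s - t)) + S t s x)"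
    and N: "\<And>t. t \<ge> 0 \<Longrightarrow> neumann (q' t) (v' t) (\<lambda>x. p t x * q' t x + s t x)"
    and p: "jcont a b p" "\<And>t x. t \<ge> 0 \<Longrightarrow> x \<in> {a..b} \<Longrightarrow> p t x > 0"
    and P: "\<And>t. t \<ge> 0 \<Longrightarrow> uniform_limit {a..b} (P t) (p t) (at t within {0..})"
    and S: "\<And>t. t \<ge> 0 \<Longrightarrow> uniform_limit {a..b} (S t) (s t) (at t within {0..})"
  shows "time_deriv a b q q'" "time_deriv a b v v'"
proof -
  have "uniform_limit {a..b} (\<lambda>s x. (q s x - q t x) / (s - t)) (q' t) (at t within {0..})"
    "uniform_limit {a..b} (\<lambda>s x. (v s x - v t x) / (s - t)) (v' t) (at t within {0..})" if t: "t \<ge> 0" for t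
  proof -
    have ev: "\<forall>\<^sub>F s in at t within {0..}. neumann (\<lambda>x. (q s x - q t x) / (s - t)) (\<lambda>x. (v s x - v t x) / (s - t))
        (\<lambda>x. P t s x * ((q s x - q t x) / (s - t)) + S t s x)"
      unfolding eventually_at_filter using dq t by (auto intro!: always_eventually)
    show "uniform_limit {a..b} (\<lambda>s x. (q s x - q t x) / (s - t)) (q' t) (at t within {0..})"
      by (rule neumann_linear_limit(1)[OF ev N[OF t] jcont_slice[OF p(1) t] p(2)[OF t] P[OF t] S[OF t]])
    show "uniform_limit {a..b} (\<lambda>s x. (v s x - v t x) / (s - t)) (v' t) (at t within {0..})"
      by (rule neumann_linear_limit(2)[OF ev N[OF t] jcont_slice[OF p(1) t] p(2)[OF t] P[OF t] S[OF t]])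
  qed
  then show "time_deriv a b q q'" "time_deriv a b v v'"
    by (auto intro!: uniform_time_deriv)
qed

text \<open>The functions \<open>q'\<close> and \<open>q''\<close> are obtained as solutions of the formally differentiated equations
  and only then recognised as the time derivatives of \<open>q = y0 + t h - y\<close>. For the first derivative
  the coefficient of the difference quotient is \<open>\<alpha> / (y s * y t)\<close>, which tends to \<open>\<alpha> / y\<^sup>2\<close> once \<open>q\<close> is
  known to be continuous in time.\<close>
lemma singular_evolution:
  fixes \<alpha> :: real
  assumes \<alpha>: "\<alpha> > 0"
    and y0: "\<And>x. x \<in> {a..b} \<Longrightarrow> y0 x > 0" "L0-lipschitz_on {a..b} y0"
    and h: "L1-lipschitz_on {a..b} h"
  obtains y q' q'' v v' v'' where
    "\<And>t x. t \<ge> 0 \<Longrightarrow> x \<in> {a..b} \<Longrightarrow> y t x > 0"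
    "\<And>t. t \<ge> 0 \<Longrightarrow> neumann (\<lambda>x. y0 x + t * h x - y t x) (v t) (\<lambda>x. \<alpha> / y t x - \<alpha> / y0 x)"
    "\<And>t. t \<ge> 0 \<Longrightarrow> neumann (q' t) (v' t) (\<lambda>x. - \<alpha> * (h x - q' t x) / (y t x)\<^sup>2)"
    "\<And>t. t \<ge> 0 \<Longrightarrow> neumann (q'' t) (v'' t)
        (\<lambda>x. \<alpha> * q'' t x / (y t x)\<^sup>2 + 2 * \<alpha> * (h x - q' t x)\<^sup>2 / (y t x) ^ 3)"
    "jcont a b y" "jcont a b q'" "jcont a b q''"
    "jcont a b v" "jcont a b v'" "jcont a b v''"
    "time_deriv a b v v'" "time_deriv a b v' v''"
    "\<And>x. x \<in> {a..b} \<Longrightarrow> y 0 x = y0 x"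
proof -
  have cont: "continuous_on {a..b} y0" "continuous_on {a..b} h"
    using y0 h lipschitz_on_continuous_on by blast+
  obtain H where H: "H > 0" "\<And>x. x \<in> {a..b} \<Longrightarrow> \<bar>h x\<bar> \<le> H"
    using continuous_on_Icc_bounds[OF cont(2)] by blast
  have ex: "\<exists>q v. neumann q v (\<lambda>x. \<alpha> / (y0 x + t * h x - q x) - \<alpha> / y0 x) \<and>
           (\<forall>x\<in>{a..b}. y0 x + t * h x - q x > 0)" if t: "t \<ge> 0" for t
  proof (rule neumann_singular[OF \<alpha> y0])
    show "\<bar>t * h x\<bar> \<le> t * H" if "x \<in> {a..b}" for x
      using H(2)[OF that] t by (simp add: abs_mult mult_left_mono)
    show "(t * L1)-lipschitz_on {a..b} (\<lambda>x. t * h x)"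
      using lipschitz_on_cmult_real[OF h, of t] t by simp
  qed
  obtain q v where qv: "\<And>t. t \<ge> 0 \<Longrightarrow>
      neumann (q t) (v t) (\<lambda>x. \<alpha> / (y0 x + t * h x - q t x) - \<alpha> / y0 x) \<and>
           (\<forall>x\<in>{a..b}. y0 x + t * h x - q t x > 0)"
    by (rule nonneg_choice2[of "\<lambda>t q v. neumann q v (\<lambda>x. \<alpha> / (y0 x + t * h x - q x) - \<alpha> / y0 x) \<and>
        (\<forall>x\<in>{a..b}. y0 x + t * h x - q x > 0)", OF ex], assumption, rule that)
  define y where "y t x = y0 x + t * h x - q t x" for t x
  have N: "neumann (q t) (v t) (\<lambda>x. \<alpha> / y t x - \<alpha> / y0 x)" if "t \<ge> 0" for t
    using qv[OF that] by (simp add: y_def)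
  have y: "y t x > 0" if "t \<ge> 0" "x \<in> {a..b}" for t x
    using qv[OF that(1)] that(2) by (simp add: y_def)
  then have y_ne: "y t x \<noteq> 0" if "t \<ge> 0" "x \<in> {a..b}" for t x using that by force
  \<comment> \<open>The right-hand side increases with \<open>q\<close>, so the maximum principle makes \<open>q\<close> Lipschitz in time.\<close>
  have lip: "q s x - q t x \<le> H * \<bar>s - t\<bar>" if st: "s \<ge> 0" "t \<ge> 0" and x: "x \<in> {a..b}" for s t x
  proof (rule neumann_max[OF neumann_diff[OF N[OF st(1)] N[OF st(2)]] _ x])
    fix x assume x: "x \<in> {a..b}" "q s x - q t x > H * \<bar>s - t\<bar>"
    have "\<bar>(s - t) * h x\<bar> \<le> H * \<bar>s - t\<bar>"
      using H(2)[OF x(1)] by (simp add: abs_mult mult.commute mult_right_mono)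
    then have "y s x < y t x" using x(2) unfolding y_def by (simp add: abs_le_iff algebra_simps)
    then have "\<alpha> / y t x < \<alpha> / y s x"
      using \<alpha> y[OF st(1) x(1)] by (intro divide_strict_left_mono mult_pos_pos y st x) auto
    then show "\<alpha> / y s x - \<alpha> / y0 x - (\<alpha> / y t x - \<alpha> / y0 x) > 0" by simp
  qed
  have jq: "jcont a b q"
  proof (rule uniform_limit_jcont)
    fix t :: real assume t: "t \<ge> 0"
    show "continuous_on {a..b} (q t)" using neumannD(6)[OF N[OF t]] .
    show "uniform_limit {a..b} q (q t) (at t within {0..})"
    proof (rule uniform_limitI)
      fix e :: real assume "e > 0"
      have "dist (q s x) (q t x) < e" if "s \<in> {0..}" "dist s t < e / H" "x \<in> {a..b}" for s x
      proof -
        have "\<bar>q s x - q t x\<bar> \<le> H * \<bar>s - t\<bar>"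
          using lip[of s t x] lip[of t s x] that t by (auto simp: abs_le_iff abs_minus_commute)
        also have "\<dots> < e" using that(2) H(1) by (simp add: dist_real_def field_simps)
        finally show ?thesis by (simp add: dist_real_def)
      qed
      then show "\<forall>\<^sub>F s in at t within {0..}. \<forall>x\<in>{a..b}. dist (q s x) (q t x) < e"
        unfolding eventually_at using \<open>e > 0\<close> H(1) by (intro exI[of _ "e / H"]) auto
    qed
  qed
  have jy: "jcont a b y"
    unfolding y_def[abs_def] by (intro jcont_diff jcont_add jcont_mult jcont_space jcont_time cont jq)
  define p where "p t x = \<alpha> / (y t x)\<^sup>2" for t x
  have jp: "jcont a b p"
    unfolding p_def[abs_def] by (intro jcont_divide jcont_power jy jcont_space continuous_on_const) (simp add: y_ne)
  have p_pos: "p t x > 0" if "t \<ge> 0" "x \<in> {a..b}" for t x using \<alpha> y_ne[OF that] by (simp add: p_def)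
  obtain q' v' where N': "\<And>t. t \<ge> 0 \<Longrightarrow> neumann (q' t) (v' t) (\<lambda>x. p t x * q' t x + p t x * (- h x))"
    and j': "jcont a b q'" "jcont a b v'"
  proof (rule neumann_linear_evolution[OF jp p_pos])
    show "jcont a b (\<lambda>t x. p t x * (- h x))"
      by (intro jcont_mult jp jcont_minus jcont_space cont)
  qed (use that in auto)
  have "time_deriv a b q q' \<and> time_deriv a b v v'"
  proof (rule conjI)
    let ?P = "\<lambda>t s x. \<alpha> / (y s x * y t x)"
    have dq: "neumann (\<lambda>x. (q s x - q t x) / (s - t)) (\<lambda>x. (v s x - v t x) / (s - t))
        (\<lambda>x. ?P t s x * ((q s x - q t x) / (s - t)) + ?P t s x * (- h x))"
      if st: "s \<ge> 0" "t \<ge> 0" "s \<noteq> t" for s t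
    proof (rule neumann_cong[OF neumann_divide[OF neumann_diff[OF N[OF st(1)] N[OF st(2)]], of "s - t"]])
      fix x assume x: "x \<in> {a..b}"
      have e: "q s x - q t x = (s - t) * h x - (y s x - y t x)" by (simp add: y_def algebra_simps)
      have "(\<alpha> / y s x - \<alpha> / y t x) / (s - t) = ?P t s x * (((s - t) * h x - (y s x - y t x)) / (s - t) - h x)"
        using y_ne[OF st(1) x] y_ne[OF st(2) x] st(3) by (simp add: divide_simps) (simp add: algebra_simps)
      then show "(\<alpha> / y s x - \<alpha> / y0 x - (\<alpha> / y t x - \<alpha> / y0 x)) / (s - t) =
          ?P t s x * ((q s x - q t x) / (s - t)) + ?P t s x * (- h x)"
        unfolding e by (simp add: right_diff_distrib)
    qed
    have P: "jcont a b (?P t)" if "t \<ge> 0" for t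
      by (intro jcont_divide jcont_mult jy jcont_space continuous_on_const jcont_slice[OF jy that])
         (simp add: y_ne that)
    have "uniform_limit {a..b} (?P t) (p t) (at t within {0..})" if "t \<ge> 0" for t
      using jcont_uniform_limit[OF P[OF that] that] by (simp add: p_def[abs_def] power2_eq_square)
    moreover have "uniform_limit {a..b} (\<lambda>s x. ?P t s x * (- h x)) (\<lambda>x. p t x * (- h x)) (at t within {0..})" if "t \<ge> 0" for t
      using jcont_uniform_limit[OF jcont_mult[OF P[OF that] jcont_minus[OF jcont_space[OF cont(2)]]] that]
      by (simp add: p_def[abs_def] power2_eq_square)
    ultimately show "time_deriv a b q q'" "time_deriv a b v v'"
      using neumann_time_deriv[OF dq N' jp p_pos] by blast+
  qed
  then have dq: "time_deriv a b q q'" and dv: "time_deriv a b v v'" by auto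
  have dy: "((\<lambda>t. y t x) has_real_derivative (h x - q' t x)) (at t within {0..})"
    if "t \<ge> 0" "x \<in> {a..b}" for t x
    unfolding y_def using dq that unfolding time_deriv_def
    by (auto intro!: derivative_eq_intros)
  define p' where "p' t x = - 2 * \<alpha> * (h x - q' t x) / (y t x) ^ 3" for t x
  have dp: "((\<lambda>t. p t x) has_real_derivative p' t x) (at t within {0..})"
    if "t \<ge> 0" "x \<in> {a..b}" for t x
    unfolding p_def
    by (rule derivative_eq_intros dy[OF that] refl | simp add: y_ne[OF that])+
       (use y_ne[OF that] in \<open>simp add: p'_def power2_eq_square power3_eq_cube power4_eq_xxxx divide_simps\<close>)
  have jp': "jcont a b p'"
    unfolding p'_def[abs_def]
    by (intro jcont_divide jcont_mult jcont_power jcont_diff jy j' jcont_space cont continuous_on_const) (simp add: y_ne)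
  obtain q'' v'' where N'': "\<And>t. t \<ge> 0 \<Longrightarrow> neumann (q'' t) (v'' t) (\<lambda>x. p t x * q'' t x + p' t x * (q' t x - h x))"
    and j'': "jcont a b q''" "jcont a b v''"
  proof (rule neumann_linear_evolution[OF jp p_pos])
    show "jcont a b (\<lambda>t x. p' t x * (q' t x - h x))"
      by (intro jcont_mult jp' jcont_diff j' jcont_space cont)
  qed (use that in auto)
  have dv': "time_deriv a b v' v''"
  proof -
    let ?S = "\<lambda>t s x. (p s x * (q' t x - h x) - p t x * (q' t x - h x)) / (s - t)"
    have dq: "neumann (\<lambda>x. (q' s x - q' t x) / (s - t)) (\<lambda>x. (v' s x - v' t x) / (s - t))
        (\<lambda>x. p s x * ((q' s x - q' t x) / (s - t)) + ?S t s x)"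
      if st: "s \<ge> 0" "t \<ge> 0" "s \<noteq> t" for s t
      by (rule neumann_cong[OF neumann_divide[OF neumann_diff[OF N'[OF st(1)] N'[OF st(2)]], of "s - t"]])
         (use st in \<open>simp add: divide_simps\<close>; simp add: algebra_simps)
    have S: "uniform_limit {a..b} (?S t) (\<lambda>x. p' t x * (q' t x - h x)) (at t within {0..})" if t: "t \<ge> 0" for t
    proof -
      have c: "continuous_on {a..b} (\<lambda>x. q' t x - h x)"
        by (intro continuous_intros jcont_slice[OF j'(1) t] cont)
      have "time_deriv a b (\<lambda>s x. p s x * (q' t x - h x)) (\<lambda>s x. p' s x * (q' t x - h x))"
        unfolding time_deriv_def by (auto intro!: DERIV_cmult_right dp)
      from time_deriv_uniform[OF this jcont_mult[OF jp' jcont_space[OF c]] t] show ?thesis .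
    qed
    show ?thesis
      by (rule neumann_time_deriv(2)[OF dq N'' jp p_pos jcont_uniform_limit[OF jp] S])
  qed
  have y_init: "y 0 x = y0 x" if x: "x \<in> {a..b}" for x
  proof -
    have N0: "neumann (q 0) (v 0) (\<lambda>x. \<alpha> / y 0 x - \<alpha> / y0 x)" by (rule N) simp
    have "q 0 x \<le> 0"
    proof (rule neumann_max[OF N0 _ x])
      fix x assume x: "x \<in> {a..b}" "q 0 x > 0"
      then have "\<alpha> / y0 x < \<alpha> / y 0 x"
        using \<alpha> y[of 0 x] y0(1) by (intro divide_strict_left_mono mult_pos_pos) (auto simp: y_def)
      then show "\<alpha> / y 0 x - \<alpha> / y0 x > 0" by simp
    qed
    moreover have "q 0 x \<ge> 0"
    proof (rule neumann_min[OF N0 _ x])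
      fix x assume x: "x \<in> {a..b}" "q 0 x < 0"
      then have "\<alpha> / y 0 x < \<alpha> / y0 x"
        using \<alpha> y[of 0 x] y0(1) by (intro divide_strict_left_mono mult_pos_pos) (auto simp: y_def)
      then show "\<alpha> / y 0 x - \<alpha> / y0 x < 0" by simp
    qed
    ultimately show ?thesis by (simp add: y_def)
  qed
  show ?thesis
  proof (rule that[of y v q' v' q'' v''])
    show "neumann (\<lambda>x. y0 x + t * h x - y t x) (v t) (\<lambda>x. \<alpha> / y t x - \<alpha> / y0 x)" if "t \<ge> 0" for t
      using N[OF that] by (simp add: y_def)
    show "neumann (q' t) (v' t) (\<lambda>x. - \<alpha> * (h x - q' t x) / (y t x)\<^sup>2)" if "t \<ge> 0" for t
      by (rule neumann_cong[OF N'[OF that]]) (simp add: p_def algebra_simps diff_divide_distrib)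
    show "neumann (q'' t) (v'' t) (\<lambda>x. \<alpha> * q'' t x / (y t x)\<^sup>2 + 2 * \<alpha> * (h x - q' t x)\<^sup>2 / (y t x) ^ 3)"
      if "t \<ge> 0" for t
      by (rule neumann_cong[OF N''[OF that]])
         (simp add: p_def p'_def power2_eq_square algebra_simps diff_divide_distrib add_divide_distrib)
    have jr: "jcont a b (\<lambda>t x. \<alpha> / y t x - \<alpha> / y0 x)"
      using y0(1) by (intro jcont_diff jcont_divide jy jcont_space cont continuous_on_const) (force simp: y_ne)+
    show "jcont a b v"
      by (rule neumann_velocity_jcont[of q v "\<lambda>t x. \<alpha> / y t x - \<alpha> / y0 x", OF N jr])
  qed (use y jy j' j'' dv dv' y_init in auto)
qed

end

section \<open>Joint regularity and curves in the Banach space\<close>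

text \<open>All space derivatives up to order \<open>j\<close> are jointly continuous in time and space. In contrast to
  convergence in the norm of \<open>C\<^sup>k\<close>, this notion is visibly stable under arithmetic, and it yields
  norm continuity because the space interval is compact.\<close>
fun jCk :: "real \<Rightarrow> real \<Rightarrow> nat \<Rightarrow> (real \<Rightarrow> real \<Rightarrow> real) \<Rightarrow> bool" where
  "jCk a b 0 \<gamma> \<longleftrightarrow> jcont a b \<gamma>"
| "jCk a b (Suc j) \<gamma> \<longleftrightarrow> jcont a b \<gamma> \<and>
     (\<exists>\<delta>. jCk a b j \<delta> \<and>
       (\<forall>t\<ge>0. \<forall>x\<in>{a..b}. (\<gamma> t has_real_derivative \<delta> t x) (at x within {a..b})))"

lemma jCk_jcont: "jCk a b j \<gamma> \<Longrightarrow> jcont a b \<gamma>"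
  by (cases j) auto

lemma jCk_SucI:
  assumes "jcont a b \<gamma>" "jCk a b j \<delta>"
    "\<And>t x. t \<ge> 0 \<Longrightarrow> x \<in> {a..b} \<Longrightarrow> (\<gamma> t has_real_derivative \<delta> t x) (at x within {a..b})"
  shows "jCk a b (Suc j) \<gamma>"
  using assms by auto

lemma jCk_SucE:
  assumes "jCk a b (Suc j) \<gamma>"
  obtains \<delta> where "jCk a b j \<delta>"
    "\<And>t x. t \<ge> 0 \<Longrightarrow> x \<in> {a..b} \<Longrightarrow> (\<gamma> t has_real_derivative \<delta> t x) (at x within {a..b})"
  using assms by auto

lemma jCk_Suc: "jCk a b (Suc j) \<gamma> \<Longrightarrow> jCk a b j \<gamma>"
proof (induction j arbitrary: \<gamma>)
  case 0 then show ?case by simp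
next
  case (Suc j)
  from Suc.prems obtain \<delta> where "jCk a b (Suc j) \<delta>"
    "\<And>t x. t \<ge> 0 \<Longrightarrow> x \<in> {a..b} \<Longrightarrow> (\<gamma> t has_real_derivative \<delta> t x) (at x within {a..b})"
    by (rule jCk_SucE) (rule that)
  then show ?case using Suc.IH[of \<delta>] jCk_jcont[OF Suc.prems] by (intro jCk_SucI) auto
qed

lemma jCk_mono: "jCk a b k \<gamma> \<Longrightarrow> j \<le> k \<Longrightarrow> jCk a b j \<gamma>"
  by (induction k) (auto simp: le_Suc_eq dest: jCk_Suc simp del: jCk.simps(2))

lemma jCk_const: "jCk a b j (\<lambda>t x. c)"
proof (induction j arbitrary: c)
  case 0 show ?case by (simp add: jcont_space)
next
  case (Suc j)
  show ?case by (rule jCk_SucI[OF _ Suc.IH[of 0]]) (auto intro: jcont_space)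
qed

lemma jCk_time: "jCk a b j (\<lambda>t x. t)"
proof (cases j)
  case (Suc i)
  show ?thesis unfolding Suc by (rule jCk_SucI[OF _ jCk_const[of _ _ _ 0]]) auto
qed (simp add: jcont_time)

lemma jCk_add: "jCk a b j f \<Longrightarrow> jCk a b j g \<Longrightarrow> jCk a b j (\<lambda>t x. f t x + g t x)"
proof (induction j arbitrary: f g)
  case 0 then show ?case by (simp add: jcont_add)
next
  case (Suc j)
  from Suc.prems(1) obtain f' where f': "jCk a b j f'"
    "\<And>t x. t \<ge> 0 \<Longrightarrow> x \<in> {a..b} \<Longrightarrow> (f t has_real_derivative f' t x) (at x within {a..b})"
    by (rule jCk_SucE) (rule that)
  from Suc.prems(2) obtain g' where g': "jCk a b j g'"
    "\<And>t x. t \<ge> 0 \<Longrightarrow> x \<in> {a..b} \<Longrightarrow> (g t has_real_derivative g' t x) (at x within {a..b})"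
    by (rule jCk_SucE) (rule that)
  show ?case
    by (rule jCk_SucI[OF _ Suc.IH[OF f'(1) g'(1)]])
       (auto intro!: jcont_add jCk_jcont[OF Suc.prems(1)] jCk_jcont[OF Suc.prems(2)] DERIV_add f' g')
qed

lemma jCk_mult: "jCk a b j f \<Longrightarrow> jCk a b j g \<Longrightarrow> jCk a b j (\<lambda>t x. f t x * g t x)"
proof (induction j arbitrary: f g)
  case 0 then show ?case by (simp add: jcont_mult)
next
  case (Suc j)
  from Suc.prems(1) obtain f' where f': "jCk a b j f'"
    "\<And>t x. t \<ge> 0 \<Longrightarrow> x \<in> {a..b} \<Longrightarrow> (f t has_real_derivative f' t x) (at x within {a..b})"
    by (rule jCk_SucE) (rule that)
  from Suc.prems(2) obtain g' where g': "jCk a b j g'"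
    "\<And>t x. t \<ge> 0 \<Longrightarrow> x \<in> {a..b} \<Longrightarrow> (g t has_real_derivative g' t x) (at x within {a..b})"
    by (rule jCk_SucE) (rule that)
  show ?case
    by (rule jCk_SucI[OF _ jCk_add[OF Suc.IH[OF f'(1) jCk_Suc[OF Suc.prems(2)]]
            Suc.IH[OF g'(1) jCk_Suc[OF Suc.prems(1)]]]])
       (auto intro!: jcont_mult jCk_jcont[OF Suc.prems(1)] jCk_jcont[OF Suc.prems(2)] DERIV_mult f' g')
qed

lemma jCk_minus: "jCk a b j f \<Longrightarrow> jCk a b j (\<lambda>t x. - f t x)"
  using jCk_mult[OF jCk_const[of a b j "-1"], of f] by simp

lemma jCk_diff: "jCk a b j f \<Longrightarrow> jCk a b j g \<Longrightarrow> jCk a b j (\<lambda>t x. f t x - g t x)"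
  using jCk_add[of a b j f "\<lambda>t x. - g t x"] jCk_minus[of a b j g] by simp

lemma jCk_power: "jCk a b j f \<Longrightarrow> jCk a b j (\<lambda>t x. f t x ^ n)"
  by (induction n) (auto intro: jCk_const jCk_mult)

lemma jCk_inverse:
  "jCk a b j g \<Longrightarrow> (\<And>t x. t \<ge> 0 \<Longrightarrow> x \<in> {a..b} \<Longrightarrow> g t x \<noteq> 0) \<Longrightarrow>
    jCk a b j (\<lambda>t x. inverse (g t x))"
proof (induction j)
  case 0
  then show ?case using jcont_divide[OF jcont_space[OF continuous_on_const[of _ 1]], of a b g]
    by (simp add: inverse_eq_divide)
next
  case (Suc j)
  from Suc.prems(1) obtain g' where g': "jCk a b j g'"
    "\<And>t x. t \<ge> 0 \<Longrightarrow> x \<in> {a..b} \<Longrightarrow> (g t has_real_derivative g' t x) (at x within {a..b})"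
    by (rule jCk_SucE) (rule that)
  have inv: "jCk a b j (\<lambda>t x. inverse (g t x))"
    using Suc.IH[OF jCk_Suc[OF Suc.prems(1)] Suc.prems(2)] .
  show ?case
  proof (rule jCk_SucI)
    show "jcont a b (\<lambda>t x. inverse (g t x))" using jCk_jcont[OF inv] .
    show "jCk a b j (\<lambda>t x. - (inverse (g t x) * g' t x * inverse (g t x)))"
      by (intro jCk_minus jCk_mult inv g')
    show "((\<lambda>x. inverse (g t x)) has_real_derivative - (inverse (g t x) * g' t x * inverse (g t x)))
        (at x within {a..b})" if "t \<ge> 0" "x \<in> {a..b}" for t x
      by (rule DERIV_inverse'[OF g'(2)[OF that] Suc.prems(2)[OF that]])
  qed
qed

lemma jCk_divide:
  "jCk a b j f \<Longrightarrow> jCk a b j g \<Longrightarrow> (\<And>t x. t \<ge> 0 \<Longrightarrow> x \<in> {a..b} \<Longrightarrow> g t x \<noteq> 0) \<Longrightarrow>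
    jCk a b j (\<lambda>t x. f t x / g t x)"
  unfolding divide_inverse by (intro jCk_mult jCk_inverse)

lemma has_real_derivative_transform:
  fixes f g :: "real \<Rightarrow> real"
  assumes "x \<in> S" "\<And>x. x \<in> S \<Longrightarrow> g x = f x" "(f has_real_derivative D) (at x within S)"
  shows "(g has_real_derivative D) (at x within S)"
  using has_vector_derivative_transform[OF assms(1,2)] assms(3)
  by (simp add: has_real_derivative_iff_has_vector_derivative)

lemma dx_eq:
  assumes "(f has_real_derivative D) (at x within {a..b})" "a < b" "x \<in> {a..b}"
  shows "dx a b f x = D"
  unfolding dx_def
  using assms by (intro vector_derivative_within_closed_interval)
    (auto simp: has_real_derivative_iff_has_vector_derivative)

lemma Ck_SucD:
  assumes "f \<in> Ck a b (Suc k)" "x \<in> {a..b}"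
  shows "(f has_real_derivative dx a b f x) (at x within {a..b})"
proof -
  have "f differentiable at x within {a..b}"
    using assms by (simp add: differentiable_on_def)
  then show ?thesis
    unfolding dx_def has_real_derivative_iff_has_vector_derivative by (rule vector_derivative_works[THEN iffD1])
qed

lemma Ck_SucI:
  assumes "g \<in> Ck a b k" "a < b"
    and "\<And>x. x \<in> {a..b} \<Longrightarrow> (f has_real_derivative g x) (at x within {a..b})"
    and cong: "\<And>h. (\<And>x. x \<in> {a..b} \<Longrightarrow> h x = g x) \<Longrightarrow> h \<in> Ck a b k"
  shows "f \<in> Ck a b (Suc k)"
proof -
  have "f differentiable_on {a..b}"
    unfolding differentiable_on_def using assms(3) real_differentiable_def by blast
  moreover have "dx a b f \<in> Ck a b k"
    by (rule cong) (auto intro!: dx_eq assms)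
  ultimately show ?thesis by simp
qed

lemma Ck_cong:
  assumes "a < b"
  shows "f \<in> Ck a b k \<Longrightarrow> (\<And>x. x \<in> {a..b} \<Longrightarrow> g x = f x) \<Longrightarrow> g \<in> Ck a b k"
proof (induction k arbitrary: f g)
  case 0 then show ?case using continuous_on_cong[of "{a..b}" "{a..b}" g f] by simp
next
  case (Suc k)
  show ?case
  proof (rule Ck_SucI[OF _ \<open>a < b\<close>])
    show *: "dx a b f \<in> Ck a b k" using Suc.prems by simp
    show "(g has_real_derivative dx a b f x) (at x within {a..b})" if "x \<in> {a..b}" for x
      using has_real_derivative_transform[OF that Suc.prems(2) Ck_SucD[OF Suc.prems(1) that]] by simp
    show "h \<in> Ck a b k" if "\<And>x. x \<in> {a..b} \<Longrightarrow> h x = dx a b f x" for h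
      using Suc.IH[OF *] that by blast
  qed
qed

lemma jCk_slice:
  assumes "a < b" "t \<ge> 0"
  shows "jCk a b k \<gamma> \<Longrightarrow> \<gamma> t \<in> Ck a b k"
proof (induction k arbitrary: \<gamma>)
  case 0 then show ?case using jcont_slice assms by simp
next
  case (Suc k)
  from Suc.prems obtain \<delta> where \<delta>: "jCk a b k \<delta>"
    "\<And>t x. t \<ge> 0 \<Longrightarrow> x \<in> {a..b} \<Longrightarrow> (\<gamma> t has_real_derivative \<delta> t x) (at x within {a..b})"
    by (rule jCk_SucE) (rule that)
  show ?case
    by (rule Ck_SucI[OF Suc.IH[OF \<delta>(1)] assms(1) \<delta>(2)[OF assms(2)]])
       (auto intro: Ck_cong[OF assms(1) Suc.IH[OF \<delta>(1)]])
qed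

lemma jCk_space: "f \<in> Ck a b k \<Longrightarrow> jCk a b k (\<lambda>t. f)"
proof (induction k arbitrary: f)
  case 0 then show ?case by (simp add: jcont_space)
next
  case (Suc k)
  show ?case
  proof (rule jCk_SucI)
    show "jcont a b (\<lambda>t. f)"
      using Ck_SucD[OF Suc.prems] by (intro jcont_space DERIV_continuous_on)
    show "jCk a b k (\<lambda>t. dx a b f)" using Suc by simp
  qed (use Ck_SucD[OF Suc.prems] in blast)
qed

lemma Ck_norm_0: "Ck_norm a b 0 f = (SUP x\<in>{a..b}. \<bar>f x\<bar>)"
  by (simp add: Ck_norm_def)

lemma Ck_norm_Suc: "Ck_norm a b (Suc k) f = Ck_norm a b 0 f + Ck_norm a b k (dx a b f)"
  unfolding Ck_norm_def by (subst sum.atMost_Suc_shift) (simp add: funpow_Suc_right del: funpow.simps)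

lemma Ck_norm_cong:
  assumes "a < b"
  shows "f \<in> Ck a b k \<Longrightarrow> (\<And>x. x \<in> {a..b} \<Longrightarrow> g x = f x) \<Longrightarrow> Ck_norm a b k g = Ck_norm a b k f"
proof (induction k arbitrary: f g)
  case 0 then show ?case by (simp add: Ck_norm_0)
next
  case (Suc k)
  have "dx a b g x = dx a b f x" if x: "x \<in> {a..b}" for x
    using has_real_derivative_transform[OF x Suc.prems(2) Ck_SucD[OF Suc.prems(1) x]] assms x
    by (intro dx_eq) auto
  then show ?case using Suc.IH[of "dx a b f" "dx a b g"] Suc.prems by (simp add: Ck_norm_Suc Ck_norm_0)
qed

lemma Ck_norm_0_tendsto:
  assumes "a < b" "uniform_limit {a..b} f g F"
  shows "((\<lambda>s. Ck_norm a b 0 (\<lambda>x. f s x - g x)) \<longlongrightarrow> 0) F"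
proof (rule tendstoI)
  fix e :: real assume "e > 0"
  then have "e / 2 > 0" by simp
  from uniform_limitD[OF assms(2) this]
  show "\<forall>\<^sub>F s in F. dist (Ck_norm a b 0 (\<lambda>x. f s x - g x)) 0 < e"
  proof eventually_elim
    case (elim s)
    have ne: "{a..b} \<noteq> {}" using assms(1) by simp
    have bd: "\<bar>f s x - g x\<bar> \<le> e / 2" if "x \<in> {a..b}" for x
      using elim that by (force simp: dist_real_def)
    have "(SUP x\<in>{a..b}. \<bar>f s x - g x\<bar>) \<le> e / 2"
      by (rule cSUP_least[OF ne bd])
    moreover have "0 \<le> (SUP x\<in>{a..b}. \<bar>f s x - g x\<bar>)"
      by (rule cSUP_upper2[OF bdd_aboveI2[OF bd], where x=a]) (use assms(1) in auto)
    ultimately show ?case using \<open>e > 0\<close> by (simp add: Ck_norm_0)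
  qed
qed

lemma Ck_norm_Suc_tendsto:
  assumes "a < b"
    and "((\<lambda>s. Ck_norm a b 0 (f s)) \<longlongrightarrow> 0) F" "((\<lambda>s. Ck_norm a b k (g s)) \<longlongrightarrow> 0) F"
    and "\<forall>\<^sub>F s in F. g s \<in> Ck a b k \<and> (\<forall>x\<in>{a..b}. (f s has_real_derivative g s x) (at x within {a..b}))"
  shows "((\<lambda>s. Ck_norm a b (Suc k) (f s)) \<longlongrightarrow> 0) F"
proof -
  have "((\<lambda>s. Ck_norm a b 0 (f s) + Ck_norm a b k (g s)) \<longlongrightarrow> 0 + 0) F"
    by (intro tendsto_add assms)
  moreover have "\<forall>\<^sub>F s in F. Ck_norm a b 0 (f s) + Ck_norm a b k (g s) = Ck_norm a b (Suc k) (f s)"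
    using assms(4)
  proof eventually_elim
    case (elim s)
    then have "Ck_norm a b k (dx a b (f s)) = Ck_norm a b k (g s)"
      by (intro Ck_norm_cong[OF assms(1)]) (auto intro!: dx_eq assms(1))
    then show ?case by (simp add: Ck_norm_Suc)
  qed
  ultimately show ?thesis by (simp add: tendsto_cong)
qed

text \<open>Exchanging the derivatives: \<open>\<gamma> s - \<gamma> 0\<close> is the time integral of \<open>\<gamma>'\<close>, which may be
  differentiated in space under the integral sign, and the fundamental theorem of calculus
  then applies to the result.\<close>
lemma time_deriv_space_deriv:
  assumes "a < b"
    and \<gamma>: "time_deriv a b \<gamma> \<gamma>'" "jcont a b \<gamma>'" and \<delta>': "jcont a b \<delta>'"
    and d: "\<And>t x. t \<ge> 0 \<Longrightarrow> x \<in> {a..b} \<Longrightarrow> (\<gamma> t has_real_derivative \<delta> t x) (at x within {a..b})"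
    and d': "\<And>t x. t \<ge> 0 \<Longrightarrow> x \<in> {a..b} \<Longrightarrow> (\<gamma>' t has_real_derivative \<delta>' t x) (at x within {a..b})"
  shows "time_deriv a b \<delta> \<delta>'"
  unfolding time_deriv_def
proof (intro allI impI ballI)
  fix t x assume t: "t \<ge> (0::real)" and x: "x \<in> {a..b}"
  have slice: "continuous_on {0..s} (\<lambda>r. \<beta> r y)" if "jcont a b \<beta>" "y \<in> {a..b}" for s y and \<beta> :: "real \<Rightarrow> real \<Rightarrow> real"
    using continuous_on_compose2[OF that(1)[unfolded jcont_def], of "{0..s}" "\<lambda>r. (r, y)"] that(2)
    by (simp add: continuous_on_Pair image_subset_iff)
  have ftc: "\<gamma> s y - \<gamma> 0 y = integral {0..s} (\<lambda>r. \<gamma>' r y)" if s: "s \<ge> 0" and y: "y \<in> {a..b}" for s y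
  proof -
    have "((\<lambda>r. \<gamma>' r y) has_integral (\<gamma> s y - \<gamma> 0 y)) {0..s}"
    proof (rule fundamental_theorem_of_calculus[OF s])
      fix r assume r: "r \<in> {0..s}"
      then have "((\<lambda>r. \<gamma> r y) has_real_derivative \<gamma>' r y) (at r within {0..})"
        using \<gamma>(1) y by (auto simp: time_deriv_def)
      then show "((\<lambda>r. \<gamma> r y) has_vector_derivative \<gamma>' r y) (at r within {0..s})"
        unfolding has_real_derivative_iff_has_vector_derivative[symmetric]
        by (rule DERIV_subset) auto
    qed
    then show ?thesis by (simp add: integral_unique)
  qed
  have e: "\<delta> s x = \<delta> 0 x + integral {0..s} (\<lambda>r. \<delta>' r x)" if s: "s \<ge> 0" for s
  proof -
    have "((\<lambda>y. integral (cbox 0 s) (\<lambda>r. \<gamma>' r y)) has_field_derivative integral (cbox 0 s) (\<lambda>r. \<delta>' r x)) (at x within {a..b})"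
    proof (rule leibniz_rule_field_derivative[OF _ _ _ x])
      show "((\<lambda>y. \<gamma>' r y) has_field_derivative \<delta>' r y) (at y within {a..b})"
        if "y \<in> {a..b}" "r \<in> cbox 0 s" for y r
        using d'[of r y] that by simp
      show "(\<lambda>r. \<gamma>' r y) integrable_on cbox 0 s" if "y \<in> {a..b}" for y
        using integrable_continuous_interval[OF slice[OF \<gamma>(2) that]] by (simp add: cbox_interval)
      show "continuous_on ({a..b} \<times> cbox 0 s) (\<lambda>(y, r). \<delta>' r y)"
        unfolding split_beta
        using continuous_on_compose2[OF \<delta>'[unfolded jcont_def], of "{a..b} \<times> cbox 0 s" "\<lambda>z. (snd z, fst z)"]
        by (force intro!: continuous_intros)
    qed simp
    then have "((\<lambda>y. \<gamma> s y - \<gamma> 0 y) has_real_derivative integral {0..s} (\<lambda>r. \<delta>' r x)) (at x within {a..b})"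
      using has_real_derivative_transform[OF x, of "\<lambda>y. \<gamma> s y - \<gamma> 0 y"] ftc[OF s]
      by (simp add: cbox_interval)
    moreover have "((\<lambda>y. \<gamma> s y - \<gamma> 0 y) has_real_derivative \<delta> s x - \<delta> 0 x) (at x within {a..b})"
      by (intro DERIV_diff d s x) simp
    ultimately have "integral {0..s} (\<lambda>r. \<delta>' r x) = \<delta> s x - \<delta> 0 x"
      using dx_eq[OF _ \<open>a < b\<close> x] by metis
    then show ?thesis by simp
  qed
  have "((\<lambda>s. integral {0..s} (\<lambda>r. \<delta>' r x)) has_real_derivative \<delta>' t x) (at t within {0..t + 1})"
    using integral_has_real_derivative[OF slice[OF \<delta>' x], of t "t + 1"] t by simp
  then have "((\<lambda>s. \<delta> 0 x + integral {0..s} (\<lambda>r. \<delta>' r x)) has_real_derivative \<delta>' t x) (at t within {0..t + 1})"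
    by (auto intro!: derivative_eq_intros)
  moreover have "at t within {0..t + 1} = at t within {0..}"
    by (rule at_within_nhd[of _ "{..<t + 1}"]) auto
  ultimately have I: "((\<lambda>s. \<delta> 0 x + integral {0..s} (\<lambda>r. \<delta>' r x)) has_real_derivative \<delta>' t x) (at t within {0..})"
    by simp
  show "((\<lambda>s. \<delta> s x) has_real_derivative \<delta>' t x) (at t within {0..})"
    by (rule has_real_derivative_transform[OF _ e I]) (use t in simp_all)
qed

lemma jCk_curve_continuous:
  assumes "a < b" "jCk a b k \<gamma>"
  shows "Ck_curve_continuous a b k \<gamma>"
proof -
  have "((\<lambda>s. Ck_norm a b k (\<lambda>x. \<gamma> s x - \<gamma> t x)) \<longlongrightarrow> 0) (at t within {0..})" if t: "t \<ge> 0" for t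
    using assms(2)
  proof (induction k arbitrary: \<gamma>)
    case 0
    then show ?case using Ck_norm_0_tendsto[OF assms(1) jcont_uniform_limit[OF _ t]] by simp
  next
    case (Suc k)
    from Suc.prems obtain \<delta> where \<delta>: "jCk a b k \<delta>"
      "\<And>t x. t \<ge> 0 \<Longrightarrow> x \<in> {a..b} \<Longrightarrow> (\<gamma> t has_real_derivative \<delta> t x) (at x within {a..b})"
      by (rule jCk_SucE) (rule that)
    show ?case
    proof (rule Ck_norm_Suc_tendsto[OF assms(1) _ Suc.IH[OF \<delta>(1)]])
      show "((\<lambda>s. Ck_norm a b 0 (\<lambda>x. \<gamma> s x - \<gamma> t x)) \<longlongrightarrow> 0) (at t within {0..})"
        by (rule Ck_norm_0_tendsto[OF assms(1) jcont_uniform_limit[OF jCk_jcont[OF Suc.prems] t]])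
      have "(\<lambda>x. \<delta> s x - \<delta> t x) \<in> Ck a b k \<and>
          (\<forall>x\<in>{a..b}. ((\<lambda>x. \<gamma> s x - \<gamma> t x) has_real_derivative \<delta> s x - \<delta> t x) (at x within {a..b}))"
        if s: "s \<ge> 0" for s
      proof
        show "(\<lambda>x. \<delta> s x - \<delta> t x) \<in> Ck a b k"
          using jCk_slice[OF assms(1) s jCk_diff[OF jCk_space jCk_space, OF jCk_slice[OF assms(1) s \<delta>(1)]
              jCk_slice[OF assms(1) t \<delta>(1)]]] .
      qed (auto intro!: DERIV_diff \<delta>(2) s t)
      then show "\<forall>\<^sub>F s in at t within {0..}. (\<lambda>x. \<delta> s x - \<delta> t x) \<in> Ck a b k \<and>
          (\<forall>x\<in>{a..b}. ((\<lambda>x. \<gamma> s x - \<gamma> t x) has_real_derivative \<delta> s x - \<delta> t x) (at x within {a..b}))"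
        unfolding eventually_at_filter by (auto intro!: always_eventually)
    qed
  qed
  then show ?thesis
    unfolding Ck_curve_continuous_def using jCk_slice[OF assms(1) _ assms(2)] by blast
qed

text \<open>Pointwise time derivatives suffice: they pass to the space derivatives by
  \<open>time_deriv_space_deriv\<close>, and each order then converges uniformly by
  \<open>time_deriv_uniform\<close>.\<close>
lemma jCk_curve_has_deriv:
  assumes "a < b" "jCk a b k \<gamma>" "jCk a b k \<gamma>'" "time_deriv a b \<gamma> \<gamma>'"
  shows "Ck_curve_has_deriv a b k \<gamma> \<gamma>'"
proof -
  have "((\<lambda>s. Ck_norm a b k (\<lambda>x. (\<gamma> s x - \<gamma> t x) / (s - t) - \<gamma>' t x)) \<longlongrightarrow> 0) (at t within {0..})"
    if t: "t \<ge> 0" for t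
    using assms(2-4)
  proof (induction k arbitrary: \<gamma> \<gamma>')
    case 0
    then show ?case using Ck_norm_0_tendsto[OF assms(1) time_deriv_uniform[OF _ _ t]] by simp
  next
    case (Suc k)
    from Suc.prems(1) obtain \<delta> where \<delta>: "jCk a b k \<delta>"
      "\<And>t x. t \<ge> 0 \<Longrightarrow> x \<in> {a..b} \<Longrightarrow> (\<gamma> t has_real_derivative \<delta> t x) (at x within {a..b})"
      by (rule jCk_SucE) (rule that)
    from Suc.prems(2) obtain \<delta>' where \<delta>': "jCk a b k \<delta>'"
      "\<And>t x. t \<ge> 0 \<Longrightarrow> x \<in> {a..b} \<Longrightarrow> (\<gamma>' t has_real_derivative \<delta>' t x) (at x within {a..b})"
      by (rule jCk_SucE) (rule that)
    have dd: "time_deriv a b \<delta> \<delta>'"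
      by (rule time_deriv_space_deriv[OF assms(1) Suc.prems(3) jCk_jcont[OF Suc.prems(2)] jCk_jcont[OF \<delta>'(1)] \<delta>(2) \<delta>'(2)])
    show ?case
    proof (rule Ck_norm_Suc_tendsto[OF assms(1) _ Suc.IH[OF \<delta>(1) \<delta>'(1) dd]])
      show "((\<lambda>s. Ck_norm a b 0 (\<lambda>x. (\<gamma> s x - \<gamma> t x) / (s - t) - \<gamma>' t x)) \<longlongrightarrow> 0) (at t within {0..})"
        by (rule Ck_norm_0_tendsto[OF assms(1) time_deriv_uniform[OF Suc.prems(3) jCk_jcont[OF Suc.prems(2)] t]])
      have "(\<lambda>x. (\<delta> s x - \<delta> t x) / (s - t) - \<delta>' t x) \<in> Ck a b k \<and>
          (\<forall>x\<in>{a..b}. ((\<lambda>x. (\<gamma> s x - \<gamma> t x) / (s - t) - \<gamma>' t x) has_real_derivative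
             (\<delta> s x - \<delta> t x) / (s - t) - \<delta>' t x) (at x within {a..b}))"
        if s: "s \<ge> 0" "s \<noteq> t" for s
      proof
        have "jCk a b k (\<lambda>r x. (\<delta> s x - \<delta> t x) / (s - t) - \<delta>' t x)"
          by (intro jCk_divide jCk_diff jCk_const jCk_space[OF jCk_slice[OF assms(1)]] \<delta> \<delta>' s t)
             (use s in simp)
        from jCk_slice[OF assms(1) t this]
        show "(\<lambda>x. (\<delta> s x - \<delta> t x) / (s - t) - \<delta>' t x) \<in> Ck a b k" .
      qed (auto intro!: DERIV_diff DERIV_cdivide \<delta>(2) \<delta>'(2) s t)
      then show "\<forall>\<^sub>F s in at t within {0..}. (\<lambda>x. (\<delta> s x - \<delta> t x) / (s - t) - \<delta>' t x) \<in> Ck a b k \<and>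
          (\<forall>x\<in>{a..b}. ((\<lambda>x. (\<gamma> s x - \<gamma> t x) / (s - t) - \<gamma>' t x) has_real_derivative
             (\<delta> s x - \<delta> t x) / (s - t) - \<delta>' t x) (at x within {a..b}))"
        unfolding eventually_at_filter by (auto intro!: always_eventually)
    qed
  qed
  then show ?thesis
    unfolding Ck_curve_has_deriv_def
    using jCk_slice[OF assms(1) _ assms(2)] jCk_slice[OF assms(1) _ assms(3)] by blast
qed

lemma Ck_Suc_lipschitz:
  assumes "f \<in> Ck a b (Suc k)"
  obtains L where "L-lipschitz_on {a..b} f"
proof -
  have "continuous_on {a..b} (dx a b f)"
    using jcont_slice[OF jCk_jcont[OF jCk_space], of "dx a b f" a b k 0] assms by simp
  then obtain B where B: "B > 0" "\<And>x. x \<in> {a..b} \<Longrightarrow> \<bar>dx a b f x\<bar> \<le> B"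
    using continuous_on_Icc_bounds by blast
  have "B-lipschitz_on {a..b} f"
  proof (rule lipschitz_onI)
    fix x y assume xy: "x \<in> {a..b}" "y \<in> {a..b}"
    show "dist (f x) (f y) \<le> B * dist x y"
    proof (cases "x = y")
      case False
      then obtain \<xi> where "\<xi> \<in> {a..b}" "f x - f y = dx a b f \<xi> * (x - y)"
        using mvt_between[OF Ck_SucD[OF assms] xy(2,1)] by metis
      then show ?thesis using B(2)[of \<xi>] by (simp add: dist_real_def abs_mult mult_right_mono)
    qed simp
  qed (use B in simp)
  then show ?thesis using that by blast
qed

section \<open>Directional derivatives of the potential\<close>

lemma Ck_add_mult:
  assumes "a < b" "f \<in> Ck a b k" "g \<in> Ck a b k"
  shows "(\<lambda>x. f x + r * g x) \<in> Ck a b k"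
  using jCk_slice[OF assms(1) order_refl jCk_add[OF jCk_space[OF assms(2)]
        jCk_mult[OF jCk_const jCk_space[OF assms(3)]]]] .

lemma dx_add_mult:
  assumes "a < b" "f \<in> Ck a b (Suc k)" "g \<in> Ck a b (Suc k)" "x \<in> {a..b}"
  shows "dx a b (\<lambda>x. f x + r * g x) x = dx a b f x + r * dx a b g x"
  using assms by (intro dx_eq DERIV_add DERIV_cmult Ck_SucD)

lemma positive_perturbation:
  fixes f g :: "real \<Rightarrow> real"
  assumes "continuous_on {a..b} f" "\<And>x. x \<in> {a..b} \<Longrightarrow> f x > 0" "continuous_on {a..b} g"
  obtains e where "e > 0" "\<And>r x. \<bar>r\<bar> \<le> e \<Longrightarrow> x \<in> {a..b} \<Longrightarrow> f x + r * g x > 0"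
proof -
  obtain m where m: "m > 0" "\<And>x. x \<in> {a..b} \<Longrightarrow> m \<le> f x"
    using continuous_on_Icc_pos[OF assms(1,2)] by blast
  obtain B where B: "B > 0" "\<And>x. x \<in> {a..b} \<Longrightarrow> \<bar>g x\<bar> \<le> B"
    using continuous_on_Icc_bounds[OF assms(3)] by blast
  show ?thesis
  proof (rule that[of "m / (2 * B)"])
    fix r x assume r: "\<bar>r\<bar> \<le> m / (2 * B)" and x: "x \<in> {a..b}"
    have "\<bar>r * g x\<bar> \<le> m / (2 * B) * B"
      unfolding abs_mult using r B(2)[OF x] m(1) B(1) by (intro mult_mono) auto
    also have "\<dots> = m / 2" using B(1) by simp
    finally show "f x + r * g x > 0" using m(1) m(2)[OF x] by linarith
  qed (use m B in simp)
qed

locale weighted_measure = weighted_interval +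
  fixes \<mu> :: "real measure"
  assumes \<mu>: "\<mu> = density (restrict_space lborel {a..b}) (\<lambda>x. ennreal (\<rho> x))"
begin

lemma space_\<mu>: "space \<mu> = {a..b}"
  by (simp add: \<mu> space_restrict_space)

lemma lint_cong: "(\<And>x. x \<in> {a..b} \<Longrightarrow> f x = g x) \<Longrightarrow> (LINT x|\<mu>. f x) = (LINT x|\<mu>. g x)"
  by (rule Bochner_Integration.integral_cong) (auto simp: space_\<mu>)

lemma lint_eq_integral:
  fixes f :: "real \<Rightarrow> real"
  assumes f: "continuous_on {a..b} f"
  shows "(LINT x|\<mu>. f x) = integral {a..b} (\<lambda>x. \<rho> x * f x)"
proof -
  have meas: "g \<in> borel_measurable (restrict_space lborel {a..b})" if "continuous_on {a..b} g" for g :: "real \<Rightarrow> real"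
    using borel_measurable_continuous_on_restrict[OF that]
    by (simp cong: measurable_cong_sets add: sets_restrict_space)
  have "(LINT x|\<mu>. f x) = (LINT x|restrict_space lborel {a..b}. \<rho> x *\<^sub>R f x)"
    unfolding \<mu>
  proof (rule integral_density[OF meas[OF f] meas[OF \<rho>_cont]])
    show "AE x in restrict_space lborel {a..b}. 0 \<le> \<rho> x"
      using \<rho>_pos by (intro AE_I2) (force simp: space_restrict_space)
  qed
  also have "\<dots> = (LINT x:{a..b}|lborel. \<rho> x *\<^sub>R f x)"
    unfolding set_lebesgue_integral_def by (rule integral_restrict_space) simp
  also have "\<dots> = integral {a..b} (\<lambda>x. \<rho> x *\<^sub>R f x)"
    by (intro set_borel_integral_eq_integral(2) borel_integrable_atLeastAtMost' continuous_intros \<rho>_cont f)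
  finally show ?thesis by simp
qed

text \<open>The identity \<open>F r = \<integral> G r\<close> is only asked for small \<open>r\<close>, where the perturbed map still has a
  positive derivative and the integrand is not affected by the convention for the logarithm
  and division outside their domains.\<close>
lemma deriv_lint:
  fixes G G' :: "real \<Rightarrow> real \<Rightarrow> real"
  assumes "e > 0"
    and F: "\<And>r. \<bar>r\<bar> < e \<Longrightarrow> F r = (LINT x|\<mu>. G r x)"
    and der: "\<And>r x. \<bar>r\<bar> \<le> e \<Longrightarrow> x \<in> {a..b} \<Longrightarrow> ((\<lambda>r. G r x) has_real_derivative G' r x) (at r)"
    and G: "\<And>r. \<bar>r\<bar> \<le> e \<Longrightarrow> continuous_on {a..b} (G r)"
    and G': "continuous_on ({-e..e} \<times> {a..b}) (\<lambda>z. G' (fst z) (snd z))"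
  shows "deriv F 0 = (LINT x|\<mu>. G' 0 x)"
proof -
  have "((\<lambda>r. integral (cbox a b) (\<lambda>x. \<rho> x * G r x)) has_field_derivative
      integral (cbox a b) (\<lambda>x. \<rho> x * G' 0 x)) (at 0 within {-e..e})"
  proof (rule leibniz_rule_field_derivative)
    show "((\<lambda>r. \<rho> x * G r x) has_field_derivative \<rho> x * G' r x) (at r within {-e..e})"
      if "r \<in> {-e..e}" "x \<in> cbox a b" for r x
      using that by (intro DERIV_cmult has_field_derivative_at_within[OF der]) auto
    show "(\<lambda>x. \<rho> x * G r x) integrable_on cbox a b" if "r \<in> {-e..e}" for r
      using integrable_continuous_interval[OF continuous_on_mult[OF \<rho>_cont G]] that
      by (auto simp: cbox_interval)
    have "continuous_on ({-e..e} \<times> {a..b}) (\<lambda>z. \<rho> (snd z))"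
      by (rule continuous_on_compose2[OF \<rho>_cont continuous_on_snd[OF continuous_on_id]]) auto
    then show "continuous_on ({-e..e} \<times> cbox a b) (\<lambda>(r, x). \<rho> x * G' r x)"
      using G' by (simp add: split_beta continuous_on_mult cbox_interval)
  qed (use \<open>e > 0\<close> in auto)
  moreover have "at 0 within {-e..e} = at (0::real)"
    using \<open>e > 0\<close> by (simp add: at_within_Icc_at)
  ultimately have D: "((\<lambda>r. integral {a..b} (\<lambda>x. \<rho> x * G r x)) has_real_derivative
      integral {a..b} (\<lambda>x. \<rho> x * G' 0 x)) (at 0)"
    by (simp add: cbox_interval)
  have "continuous_on {a..b} (G' 0)"
    using continuous_on_compose2[OF G', of "{a..b}" "\<lambda>x. (0, x)"] \<open>e > 0\<close>
    by (simp add: continuous_on_Pair image_subset_iff)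
  then have "(LINT x|\<mu>. G' 0 x) = integral {a..b} (\<lambda>x. \<rho> x * G' 0 x)"
    by (rule lint_eq_integral)
  moreover have "(F has_real_derivative integral {a..b} (\<lambda>x. \<rho> x * G' 0 x)) (at 0)"
    by (rule has_field_derivative_transform_within[OF D \<open>e > 0\<close>])
       (use F lint_eq_integral[OF G] in \<open>auto simp: dist_real_def\<close>)
  ultimately show ?thesis by (simp add: DERIV_imp_deriv)
qed

lemma continuous_on_snd_strip:
  "continuous_on {a..b} f \<Longrightarrow> continuous_on (U \<times> {a..b}) (\<lambda>z. f (snd z))"
  by (erule continuous_on_compose2[OF _ continuous_on_snd[OF continuous_on_id]]) auto

lemma Ck1_continuous:
  assumes "f \<in> Ck a b (Suc 0)"
  shows "continuous_on {a..b} f" "continuous_on {a..b} (dx a b f)"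
  using assms differentiable_imp_continuous_on by auto

lemma dir_deriv_psi:
  assumes \<Phi>: "\<Phi> \<in> Ck a b (Suc 0)" "\<And>x. x \<in> {a..b} \<Longrightarrow> dx a b \<Phi> x > 0"
    and h1: "h\<^sub>1 \<in> Ck a b (Suc 0)"
  shows "dir_deriv (psi a b \<alpha> \<mu>) \<Phi> h\<^sub>1 =
    (LINT x|\<mu>. (\<Phi> x - x) * h\<^sub>1 x - \<alpha> * (dx a b h\<^sub>1 x / dx a b \<Phi> x))"
proof -
  note conts = Ck1_continuous[OF \<Phi>(1)] Ck1_continuous[OF h1]
  note strips = conts[THEN continuous_on_snd_strip]
  obtain e where e: "e > 0" "\<And>r x. \<bar>r\<bar> \<le> e \<Longrightarrow> x \<in> {a..b} \<Longrightarrow> dx a b \<Phi> x + r * dx a b h\<^sub>1 x > 0"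
    using positive_perturbation[OF conts(2) \<Phi>(2) conts(4)] by blast
  let ?G = "\<lambda>r x. (\<Phi> x + r * h\<^sub>1 x - x)\<^sup>2 / 2 - \<alpha> * ln (dx a b \<Phi> x + r * dx a b h\<^sub>1 x)"
  let ?G' = "\<lambda>r x. (\<Phi> x + r * h\<^sub>1 x - x) * h\<^sub>1 x - \<alpha> * (dx a b h\<^sub>1 x / (dx a b \<Phi> x + r * dx a b h\<^sub>1 x))"
  have ne: "dx a b \<Phi> x + r * dx a b h\<^sub>1 x \<noteq> 0" if "\<bar>r\<bar> \<le> e" "x \<in> {a..b}" for r x using e(2)[OF that] by simp
  have "deriv (\<lambda>r. psi a b \<alpha> \<mu> (\<lambda>x. \<Phi> x + r * h\<^sub>1 x)) 0 = (LINT x|\<mu>. ?G' 0 x)"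
  proof (rule deriv_lint[OF e(1), where G = ?G])
    show "psi a b \<alpha> \<mu> (\<lambda>x. \<Phi> x + r * h\<^sub>1 x) = (LINT x|\<mu>. ?G r x)" for r
      unfolding psi_def by (rule lint_cong) (simp add: dx_add_mult[OF ab \<Phi>(1) h1])
    show "((\<lambda>r. ?G r x) has_real_derivative ?G' r x) (at r)" if "\<bar>r\<bar> \<le> e" "x \<in> {a..b}" for r x
      by (rule derivative_eq_intros refl e(2)[OF that] | simp)+
    show "continuous_on {a..b} (?G r)" if "\<bar>r\<bar> \<le> e" for r
      by (intro continuous_intros conts) (use ne[OF that] in auto)
    show "continuous_on ({-e..e} \<times> {a..b}) (\<lambda>z. ?G' (fst z) (snd z))"
      by (intro continuous_intros strips) (use ne in \<open>auto simp: abs_le_iff\<close>)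
  qed
  then show ?thesis by (simp add: dir_deriv_def)
qed

lemma D2_psi:
  assumes \<Phi>: "\<Phi> \<in> Ck a b (Suc 0)" "\<And>x. x \<in> {a..b} \<Longrightarrow> dx a b \<Phi> x > 0"
    and h: "h\<^sub>1 \<in> Ck a b (Suc 0)" "h\<^sub>2 \<in> Ck a b (Suc 0)"
  shows "D2 (psi a b \<alpha> \<mu>) \<Phi> h\<^sub>1 h\<^sub>2 =
    (LINT x|\<mu>. h\<^sub>1 x * h\<^sub>2 x + \<alpha> * (dx a b h\<^sub>1 x * dx a b h\<^sub>2 x / (dx a b \<Phi> x)\<^sup>2))"
proof -
  note conts = Ck1_continuous[OF \<Phi>(1)] Ck1_continuous[OF h(1)] Ck1_continuous[OF h(2)]
  obtain e where e: "e > 0" "\<And>r x. \<bar>r\<bar> \<le> e \<Longrightarrow> x \<in> {a..b} \<Longrightarrow> dx a b \<Phi> x + r * dx a b h\<^sub>1 x > 0"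
    using positive_perturbation[OF conts(2) \<Phi>(2) conts(4)] by blast
  let ?G = "\<lambda>r x. (\<Phi> x + r * h\<^sub>1 x - x) * h\<^sub>2 x - \<alpha> * (dx a b h\<^sub>2 x / (dx a b \<Phi> x + r * dx a b h\<^sub>1 x))"
  let ?G' = "\<lambda>r x. h\<^sub>1 x * h\<^sub>2 x + \<alpha> * (dx a b h\<^sub>1 x * dx a b h\<^sub>2 x / (dx a b \<Phi> x + r * dx a b h\<^sub>1 x)\<^sup>2)"
  have ne: "dx a b \<Phi> x + r * dx a b h\<^sub>1 x \<noteq> 0" if "\<bar>r\<bar> \<le> e" "x \<in> {a..b}" for r x using e(2)[OF that] by simp
  have "deriv (\<lambda>r. dir_deriv (psi a b \<alpha> \<mu>) (\<lambda>x. \<Phi> x + r * h\<^sub>1 x) h\<^sub>2) 0 = (LINT x|\<mu>. ?G' 0 x)"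
  proof (rule deriv_lint[OF e(1), where G = ?G])
    show "dir_deriv (psi a b \<alpha> \<mu>) (\<lambda>x. \<Phi> x + r * h\<^sub>1 x) h\<^sub>2 = (LINT x|\<mu>. ?G r x)" if r: "\<bar>r\<bar> < e" for r
    proof (subst dir_deriv_psi[OF Ck_add_mult[OF ab \<Phi>(1) h(1)] _ h(2)])
      show "dx a b (\<lambda>x. \<Phi> x + r * h\<^sub>1 x) x > 0" if "x \<in> {a..b}" for x
        using e(2) r that by (simp add: dx_add_mult[OF ab \<Phi>(1) h(1)])
    qed (rule lint_cong, simp add: dx_add_mult[OF ab \<Phi>(1) h(1)])
    show "((\<lambda>r. ?G r x) has_real_derivative ?G' r x) (at r)" if "\<bar>r\<bar> \<le> e" "x \<in> {a..b}" for r x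
      by (rule derivative_eq_intros refl ne[OF that] | simp)+
         (use ne[OF that] in \<open>simp add: power2_eq_square\<close>)
    show "continuous_on {a..b} (?G r)" if "\<bar>r\<bar> \<le> e" for r
      by (intro continuous_intros conts) (use ne[OF that] in auto)
    show "continuous_on ({-e..e} \<times> {a..b}) (\<lambda>z. ?G' (fst z) (snd z))"
      by (intro continuous_intros conts[THEN continuous_on_snd_strip]) (use ne in \<open>auto simp: abs_le_iff\<close>)
  qed
  then show ?thesis by (simp add: D2_def dir_deriv_def[of _ \<Phi>])
qed

lemma D3_psi:
  assumes \<Phi>: "\<Phi> \<in> Ck a b (Suc 0)" "\<And>x. x \<in> {a..b} \<Longrightarrow> dx a b \<Phi> x > 0"
    and h: "h\<^sub>1 \<in> Ck a b (Suc 0)" "h\<^sub>2 \<in> Ck a b (Suc 0)" "h\<^sub>3 \<in> Ck a b (Suc 0)"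
  shows "D3 (psi a b \<alpha> \<mu>) \<Phi> h\<^sub>1 h\<^sub>2 h\<^sub>3 =
    (LINT x|\<mu>. - 2 * \<alpha> * (dx a b h\<^sub>1 x * dx a b h\<^sub>2 x * dx a b h\<^sub>3 x / (dx a b \<Phi> x) ^ 3))"
proof -
  note conts = Ck1_continuous[OF \<Phi>(1)] Ck1_continuous[OF h(1)] Ck1_continuous[OF h(2)] Ck1_continuous[OF h(3)]
  obtain e where e: "e > 0" "\<And>r x. \<bar>r\<bar> \<le> e \<Longrightarrow> x \<in> {a..b} \<Longrightarrow> dx a b \<Phi> x + r * dx a b h\<^sub>1 x > 0"
    using positive_perturbation[OF conts(2) \<Phi>(2) conts(4)] by blast
  let ?G = "\<lambda>r x. h\<^sub>2 x * h\<^sub>3 x + \<alpha> * (dx a b h\<^sub>2 x * dx a b h\<^sub>3 x / (dx a b \<Phi> x + r * dx a b h\<^sub>1 x)\<^sup>2)"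
  let ?G' = "\<lambda>r x. - 2 * \<alpha> * (dx a b h\<^sub>1 x * dx a b h\<^sub>2 x * dx a b h\<^sub>3 x / (dx a b \<Phi> x + r * dx a b h\<^sub>1 x) ^ 3)"
  have ne: "dx a b \<Phi> x + r * dx a b h\<^sub>1 x \<noteq> 0" if "\<bar>r\<bar> \<le> e" "x \<in> {a..b}" for r x using e(2)[OF that] by simp
  have "deriv (\<lambda>r. D2 (psi a b \<alpha> \<mu>) (\<lambda>x. \<Phi> x + r * h\<^sub>1 x) h\<^sub>2 h\<^sub>3) 0 = (LINT x|\<mu>. ?G' 0 x)"
  proof (rule deriv_lint[OF e(1), where G = ?G])
    show "D2 (psi a b \<alpha> \<mu>) (\<lambda>x. \<Phi> x + r * h\<^sub>1 x) h\<^sub>2 h\<^sub>3 = (LINT x|\<mu>. ?G r x)" if r: "\<bar>r\<bar> < e" for r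
    proof (subst D2_psi[OF Ck_add_mult[OF ab \<Phi>(1) h(1)] _ h(2,3)])
      show "dx a b (\<lambda>x. \<Phi> x + r * h\<^sub>1 x) x > 0" if "x \<in> {a..b}" for x
        using e(2) r that by (simp add: dx_add_mult[OF ab \<Phi>(1) h(1)])
    qed (rule lint_cong, simp add: dx_add_mult[OF ab \<Phi>(1) h(1)])
    show "((\<lambda>r. ?G r x) has_real_derivative ?G' r x) (at r)" if "\<bar>r\<bar> \<le> e" "x \<in> {a..b}" for r x
    proof -
      define P where "P = (\<lambda>r. dx a b \<Phi> x + r * dx a b h\<^sub>1 x)"
      have P: "P r \<noteq> 0" using ne[OF that] by (simp add: P_def)
      have P': "(P has_real_derivative dx a b h\<^sub>1 x) (at r)"
        unfolding P_def by (auto intro!: derivative_eq_intros)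
      have "((\<lambda>r. h\<^sub>2 x * h\<^sub>3 x + \<alpha> * (dx a b h\<^sub>2 x * dx a b h\<^sub>3 x / (P r)\<^sup>2)) has_real_derivative
          - 2 * \<alpha> * (dx a b h\<^sub>1 x * dx a b h\<^sub>2 x * dx a b h\<^sub>3 x / (P r) ^ 3)) (at r)"
        by (rule derivative_eq_intros refl P' | simp add: P)+
           (use P in \<open>simp add: divide_simps power2_eq_square power3_eq_cube power4_eq_xxxx\<close>)
      then show ?thesis by (simp add: P_def)
    qed
    show "continuous_on {a..b} (?G r)" if "\<bar>r\<bar> \<le> e" for r
      by (intro continuous_intros conts) (use ne[OF that] in auto)
    show "continuous_on ({-e..e} \<times> {a..b}) (\<lambda>z. ?G' (fst z) (snd z))"
      by (intro continuous_intros conts[THEN continuous_on_snd_strip]) (use ne in \<open>auto simp: abs_le_iff\<close>)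
  qed
  then show ?thesis by (simp add: D3_def dir_deriv_def[of _ \<Phi>])
qed

end

section \<open>Smoothness in space and the geodesic equation\<close>

context weighted_interval
begin

lemma neumann_jCk_velocity:
  assumes "\<And>t. t \<ge> 0 \<Longrightarrow> neumann (q t) (v t) (r t)" "jcont a b v"
    and "\<rho> \<in> Ck a b j" "jCk a b j r"
  shows "jCk a b (Suc j) v"
  by (rule jCk_SucI[OF assms(2) jCk_mult[OF jCk_space[OF assms(3)] assms(4)]])
     (rule neumannD(5)[OF assms(1)])

lemma neumann_jCk_potential:
  assumes "\<And>t. t \<ge> 0 \<Longrightarrow> neumann (q t) (v t) (r t)" "jcont a b q"
    and "\<rho> \<in> Ck a b j" "jCk a b j v"
  shows "jCk a b (Suc j) q"
  by (rule jCk_SucI[OF assms(2) jCk_mult[OF jCk_space[OF assms(3)] assms(4)]])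
     (rule neumannD(4)[OF assms(1)])

lemma Ck_mono: "f \<in> Ck a b k \<Longrightarrow> j \<le> k \<Longrightarrow> f \<in> Ck a b j"
  using jCk_slice[OF ab order_refl jCk_mono[OF jCk_space]] by blast

text \<open>Bootstrap: if \<open>y\<close>, \<open>q'\<close> and \<open>q''\<close> are of class \<open>C\<^sup>i\<close>, then so are the right-hand sides, hence
  \<open>v\<close>, \<open>v'\<close>, \<open>v''\<close> are of class \<open>C^(i+1)\<close> and, through \<open>\<rho> v\<close>, so are \<open>y\<close>, \<open>q'\<close>, \<open>q''\<close>. The data
  \<open>\<rho>\<close>, \<open>y0\<close> and \<open>h\<close> stop the iteration at order \<open>n\<close>; the last step then gives \<open>v\<close>, \<open>v'\<close>, \<open>v''\<close>
  one order more.\<close>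
lemma singular_evolution_smooth:
  fixes \<alpha> :: real
  assumes y: "\<And>t x. t \<ge> 0 \<Longrightarrow> x \<in> {a..b} \<Longrightarrow> y t x > 0"
    and y0: "\<And>x. x \<in> {a..b} \<Longrightarrow> y0 x > 0" "y0 \<in> Ck a b n"
    and h: "h \<in> Ck a b n" and \<rho>: "\<rho> \<in> Ck a b n"
    and N: "\<And>t. t \<ge> 0 \<Longrightarrow> neumann (\<lambda>x. y0 x + t * h x - y t x) (v t) (\<lambda>x. \<alpha> / y t x - \<alpha> / y0 x)"
    and N': "\<And>t. t \<ge> 0 \<Longrightarrow> neumann (q' t) (v' t) (\<lambda>x. - \<alpha> * (h x - q' t x) / (y t x)\<^sup>2)"
    and N'': "\<And>t. t \<ge> 0 \<Longrightarrow> neumann (q'' t) (v'' t)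
        (\<lambda>x. \<alpha> * q'' t x / (y t x)\<^sup>2 + 2 * \<alpha> * (h x - q' t x)\<^sup>2 / (y t x) ^ 3)"
    and j: "jcont a b y" "jcont a b q'" "jcont a b q''" "jcont a b v" "jcont a b v'" "jcont a b v''"
  shows "jCk a b (Suc n) v" "jCk a b (Suc n) v'" "jCk a b (Suc n) v''"
proof -
  have y_ne: "y t x \<noteq> 0" if "t \<ge> 0" "x \<in> {a..b}" for t x using y[OF that] by simp
  have y0_ne: "y0 x \<noteq> 0" if "x \<in> {a..b}" for x using y0(1)[OF that] by simp
  have v_step: "jCk a b (Suc i) v \<and> jCk a b (Suc i) v' \<and> jCk a b (Suc i) v''"
    if i: "i \<le> n" and s: "jCk a b i y" "jCk a b i q'" "jCk a b i q''" for i
  proof -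
    note c = Ck_mono[OF _ i]
    have "jCk a b i (\<lambda>t x. \<alpha> / y t x - \<alpha> / y0 x)"
      by (intro jCk_diff jCk_divide jCk_const jCk_space c s y0) (auto simp: y_ne y0_ne)
    moreover have "jCk a b i (\<lambda>t x. - \<alpha> * (h x - q' t x) / (y t x)\<^sup>2)"
      by (intro jCk_divide jCk_mult jCk_diff jCk_power jCk_const jCk_space c s h) (simp add: y_ne)
    moreover have "jCk a b i (\<lambda>t x. \<alpha> * q'' t x / (y t x)\<^sup>2 + 2 * \<alpha> * (h x - q' t x)\<^sup>2 / (y t x) ^ 3)"
      by (intro jCk_add jCk_divide jCk_mult jCk_diff jCk_power jCk_const jCk_space c s h) (simp_all add: y_ne)
    ultimately show ?thesis
      using neumann_jCk_velocity[OF N j(4) c[OF \<rho>]] neumann_jCk_velocity[OF N' j(5) c[OF \<rho>]]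
        neumann_jCk_velocity[OF N'' j(6) c[OF \<rho>]] by blast
  qed
  have "i \<le> n \<Longrightarrow> jCk a b i y \<and> jCk a b i q' \<and> jCk a b i q''" for i
  proof (induction i)
    case 0 then show ?case using j by simp
  next
    case (Suc i)
    then have i: "i \<le> n" "jCk a b i y" "jCk a b i q'" "jCk a b i q''" by auto
    from v_step[OF i] have v: "jCk a b i v" "jCk a b i v'" "jCk a b i v''"
      using jCk_Suc by blast+
    note c = Ck_mono[OF _ i(1)] Ck_mono[OF _ Suc.prems]
    have jq: "jcont a b (\<lambda>t x. y0 x + t * h x - y t x)"
      by (intro jcont_diff jcont_add jcont_mult jcont_time j(1)
          jCk_jcont[OF jCk_space[OF y0(2)]] jCk_jcont[OF jCk_space[OF h]])
    have Q: "jCk a b (Suc i) (\<lambda>t x. y0 x + t * h x - y t x)"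
      by (rule neumann_jCk_potential[OF N jq c(1)[OF \<rho>] v(1)])
    have "jCk a b (Suc i) (\<lambda>t x. y0 x + t * h x - (y0 x + t * h x - y t x))"
      by (rule jCk_diff[OF _ Q]) (intro jCk_add jCk_mult jCk_time jCk_space c(2) y0 h)
    then have "jCk a b (Suc i) y" by simp
    moreover have "jCk a b (Suc i) q'" "jCk a b (Suc i) q''"
      by (rule neumann_jCk_potential[OF N' j(2) c(1)[OF \<rho>] v(2)], assumption)
         (rule neumann_jCk_potential[OF N'' j(3) c(1)[OF \<rho>] v(3)])
    ultimately show ?case by blast
  qed
  from v_step[OF order_refl] this[OF order_refl]
  show "jCk a b (Suc n) v" "jCk a b (Suc n) v'" "jCk a b (Suc n) v''" by blast+
qed

end

text \<open>Substituting \<open>\<Phi>' = \<rho> \<alpha> / y\<close> and the equations for the space derivatives of the velocity and the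
  acceleration, the quadratic terms in \<open>d = dy/dt\<close> of the Hessian and of the third derivative
  cancel; here \<open>r\<close>, \<open>w\<close>, \<open>Q\<close>, \<open>p\<close> stand for \<open>\<rho>\<close>, \<open>v'' \<phi>\<close>, \<open>q''\<close>, \<open>\<phi>'\<close>.\<close>
lemma geodesic_integrand:
  fixes \<alpha> r y Q d p :: real
  assumes "\<alpha> \<noteq> 0" "r \<noteq> 0" "y \<noteq> 0"
  shows "r * (w + \<alpha> * (r * (\<alpha> * Q / y\<^sup>2 + 2 * \<alpha> * d\<^sup>2 / y ^ 3) * p / (r * \<alpha> / y)\<^sup>2))
      + r * (- 2 * \<alpha> * (r * (- \<alpha> * d / y\<^sup>2) * (r * (- \<alpha> * d / y\<^sup>2)) * p / (r * \<alpha> / y) ^ 3))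
      = r * w + p * Q"
proof -
  have A: "r * (\<alpha> * (r * (\<alpha> * Q / y\<^sup>2 + 2 * \<alpha> * d\<^sup>2 / y ^ 3) * p / (r * \<alpha> / y)\<^sup>2)) = p * (Q + 2 * d\<^sup>2 / y)"
    using assms by (simp add: field_simps power2_eq_square power3_eq_cube)
  have B: "r * (- 2 * \<alpha> * (r * (- \<alpha> * d / y\<^sup>2) * (r * (- \<alpha> * d / y\<^sup>2)) * p / (r * \<alpha> / y) ^ 3)) = - p * (2 * d\<^sup>2 / y)"
    using assms by (simp add: field_simps power2_eq_square power3_eq_cube)
  have split: "r * (w + X) + r * Y = r * w + (r * X + r * Y)" for X Y by (simp add: distrib_left)
  show ?thesis by (subst split, subst A, subst B) (simp add: distrib_left)
qed

lemma test_function_boundary: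
  assumes "\<phi> \<in> test_functions a b"
  shows "\<phi> a = 0" "\<phi> b = 0"
proof -
  have "closure {x. \<phi> x \<noteq> 0} \<subseteq> {a<..<b}"
    using assms by (simp add: test_functions_def)
  with closure_subset have "{x. \<phi> x \<noteq> 0} \<subseteq> {a<..<b}"
    by (rule subset_trans)
  then show "\<phi> a = 0" "\<phi> b = 0" by auto
qed

theorem mainTheorem7:
  fixes a b \<alpha> :: real and k :: nat and \<mu> :: "real measure" and \<rho> :: "real \<Rightarrow> real"
  assumes "a < b" and "\<alpha> > 0" and "k \<ge> 2"
    and "prob_space \<mu>"
    and "\<mu> = density (restrict_space lborel {a..b}) (\<lambda>x. ennreal (\<rho> x))"
    and "\<rho> \<in> Ck a b (k - 1)"
    and "\<forall>x\<in>{a..b}. \<rho> x > 0"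
  shows "\<forall>\<Phi>\<^sub>0 \<in> Diffeo a b k. \<forall>u \<in> Ck a b k. u a = 0 \<and> u b = 0 \<longrightarrow>
     (\<exists>\<Phi> \<Phi>' \<Phi>''.
        dual_geodesic a b k (psi a b \<alpha> \<mu>) \<Phi> \<Phi>' \<Phi>'' \<and>
        Ck_curve_C2 a b k \<Phi> \<Phi>' \<Phi>'' \<and>
        (\<forall>x\<in>{a..b}. \<Phi> 0 x = \<Phi>\<^sub>0 x) \<and>
        (\<forall>x\<in>{a..b}. \<Phi>' 0 x = u x))"
proof (intro ballI impI)
  fix \<Phi>\<^sub>0 u assume \<Phi>0: "\<Phi>\<^sub>0 \<in> Diffeo a b k" and u: "u \<in> Ck a b k" "u a = 0 \<and> u b = 0"
  obtain m where m: "k = Suc (Suc m)" using \<open>k \<ge> 2\<close> by (metis Suc_le_D numeral_2_eq_2 Suc_le_mono)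
  define n where "n = Suc m"
  have k: "k = Suc n" and \<rho>: "\<rho> \<in> Ck a b n" using assms(6) by (simp_all add: m n_def)
  have aI: "a \<in> {a..b}" and bI: "b \<in> {a..b}" using assms(1) by auto
  have "continuous_on {a..b} \<rho>" using jcont_slice[OF jCk_jcont[OF jCk_space[OF \<rho>]] order_refl] .
  then interpret weighted_measure a b \<rho> \<mu>
    using assms by unfold_locales auto
  have \<Phi>0': "\<Phi>\<^sub>0 \<in> Ck a b (Suc n)" "dx a b \<Phi>\<^sub>0 \<in> Ck a b n" "\<Phi>\<^sub>0 a = a" "\<Phi>\<^sub>0 b = b"
    and \<Phi>0_pos: "dx a b \<Phi>\<^sub>0 x > 0" if "x \<in> {a..b}" for x
    using \<Phi>0 that aI by (auto simp: Diffeo_def k)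
  have u': "u \<in> Ck a b (Suc n)" "dx a b u \<in> Ck a b n" using u by (auto simp: k)
  have \<Phi>0_ne: "dx a b \<Phi>\<^sub>0 x \<noteq> 0" if "x \<in> {a..b}" for x using \<Phi>0_pos[OF that] by simp
  note slice0 = jCk_slice[OF ab order_refl]
  note pos = mult_pos_pos[OF \<open>\<alpha> > 0\<close> \<rho>_pos]
  define y0 where "y0 x = \<alpha> * \<rho> x / dx a b \<Phi>\<^sub>0 x" for x
  have y0_pos: "y0 x > 0" if "x \<in> {a..b}" for x
    using pos[OF that] \<Phi>0_pos[OF that] by (simp add: y0_def)
  have "jCk a b n (\<lambda>t. y0)"
    unfolding y0_def[abs_def]
    by (intro jCk_divide jCk_mult jCk_const jCk_space \<rho> \<Phi>0'(2)[OF aI]) (simp add: \<Phi>0_ne)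
  then have y0_Ck: "y0 \<in> Ck a b n" by (rule slice0)
  obtain U where U: "U a = 0" "\<And>x. x \<in> {a..b} \<Longrightarrow> (U has_real_derivative \<rho> x * u x) (at x within {a..b})"
  proof (rule integral_antiderivative)
    show "continuous_on {a..b} (\<lambda>x. \<rho> x * u x)"
      using jcont_slice[OF jCk_jcont[OF jCk_space[OF u'(1)]] order_refl] by (intro continuous_on_mult \<rho>_cont)
  qed (rule that)
  have "jCk a b (Suc n) (\<lambda>t. U)"
    by (rule jCk_SucI[OF jcont_space[OF DERIV_continuous_on[OF U(2)]]
          jCk_mult[OF jCk_space[OF \<rho>] jCk_space[OF Ck_mono[OF u'(1)]]] U(2)]) auto
  then have U_jCk: "jCk a b n (\<lambda>t. U)" by (rule jCk_Suc)
  define h where "h x = U x - \<alpha> * \<rho> x * dx a b u x / (dx a b \<Phi>\<^sub>0 x)\<^sup>2" for x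
  have "jCk a b n (\<lambda>t. h)"
    unfolding h_def[abs_def]
    by (intro jCk_diff jCk_divide jCk_mult jCk_power jCk_const jCk_space \<rho> \<Phi>0'(2)[OF aI] u' U_jCk)
       (simp add: \<Phi>0_ne)
  then have h_Ck: "h \<in> Ck a b n" by (rule slice0)
  obtain L0 L1 where lip: "L0-lipschitz_on {a..b} y0" "L1-lipschitz_on {a..b} h"
    using Ck_Suc_lipschitz[of y0 a b m] Ck_Suc_lipschitz[of h a b m] y0_Ck h_Ck unfolding n_def by metis
  obtain y q' q'' v v' v'' where
    y: "\<And>t x. t \<ge> 0 \<Longrightarrow> x \<in> {a..b} \<Longrightarrow> y t x > 0"
    and N: "\<And>t. t \<ge> 0 \<Longrightarrow> neumann (\<lambda>x. y0 x + t * h x - y t x) (v t) (\<lambda>x. \<alpha> / y t x - \<alpha> / y0 x)"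
    and N': "\<And>t. t \<ge> 0 \<Longrightarrow> neumann (q' t) (v' t) (\<lambda>x. - \<alpha> * (h x - q' t x) / (y t x)\<^sup>2)"
    and N'': "\<And>t. t \<ge> 0 \<Longrightarrow> neumann (q'' t) (v'' t)
        (\<lambda>x. \<alpha> * q'' t x / (y t x)\<^sup>2 + 2 * \<alpha> * (h x - q' t x)\<^sup>2 / (y t x) ^ 3)"
    and j: "jcont a b y" "jcont a b q'" "jcont a b q''" "jcont a b v" "jcont a b v'" "jcont a b v''"
    and td: "time_deriv a b v v'" "time_deriv a b v' v''"
    and y_init: "\<And>x. x \<in> {a..b} \<Longrightarrow> y 0 x = y0 x"
    by (rule singular_evolution[OF \<open>\<alpha> > 0\<close> y0_pos lip], assumption, rule that; assumption)
  have y_ne: "y t x \<noteq> 0" if "t \<ge> 0" "x \<in> {a..b}" for t x using y[OF that] by simp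
  note smooth = singular_evolution_smooth[OF y y0_pos y0_Ck h_Ck \<rho> N N' N'' j, folded k]
  define \<Phi> where "\<Phi> t x = \<Phi>\<^sub>0 x + v t x" for t x
  have \<Phi>_smooth: "jCk a b k \<Phi>"
    unfolding \<Phi>_def[abs_def] using \<Phi>0'(1)[OF aI] by (intro jCk_add jCk_space smooth(1)) (simp_all add: k)
  have td\<Phi>: "time_deriv a b \<Phi> v'"
    using td(1) unfolding time_deriv_def \<Phi>_def by (auto intro!: derivative_eq_intros)
  have slice: "f t \<in> Ck a b k" "f t \<in> Ck a b (Suc 0)" if "jCk a b k f" "t \<ge> 0" for f t
    using jCk_slice[OF ab that(2,1)] Ck_mono[of "f t" k "Suc 0"] by (auto simp: k)
  note curves = jCk_curve_has_deriv[OF ab \<Phi>_smooth smooth(2) td\<Phi>]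
    jCk_curve_has_deriv[OF ab smooth(2,3) td(2)] jCk_curve_continuous[OF ab smooth(3)]
  have dx\<Phi>: "dx a b (\<Phi> t) x = \<rho> x * \<alpha> / y t x" if t: "t \<ge> 0" and x: "x \<in> {a..b}" for t x
  proof -
    have "dx a b (\<Phi> t) x = dx a b \<Phi>\<^sub>0 x + \<rho> x * (\<alpha> / y t x - \<alpha> / y0 x)"
      unfolding \<Phi>_def by (rule dx_eq[OF DERIV_add[OF Ck_SucD[OF \<Phi>0'(1)[OF aI] x] neumannD(5)[OF N[OF t] x]] ab x])
    then show ?thesis
      using \<Phi>0_ne[OF x] \<rho>_pos[OF x] \<open>\<alpha> > 0\<close> by (simp add: y0_def algebra_simps)
  qed
  have dxv: "dx a b (v' t) x = \<rho> x * (- \<alpha> * (h x - q' t x) / (y t x)\<^sup>2)"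
    "dx a b (v'' t) x = \<rho> x * (\<alpha> * q'' t x / (y t x)\<^sup>2 + 2 * \<alpha> * (h x - q' t x)\<^sup>2 / (y t x) ^ 3)"
    if t: "t \<ge> 0" and x: "x \<in> {a..b}" for t x
    using dx_eq[OF neumannD(5)[OF N'[OF t] x] ab x] dx_eq[OF neumannD(5)[OF N''[OF t] x] ab x] by blast+
  have dx\<Phi>_pos: "dx a b (\<Phi> t) x > 0" if "t \<ge> 0" "x \<in> {a..b}" for t x
    using dx\<Phi>[OF that] pos[OF that(2)] y[OF that] by (simp add: mult.commute)
  have diffeo: "\<Phi> t \<in> Diffeo a b k" if t: "t \<ge> 0" for t
    unfolding Diffeo_def
    using slice[OF \<Phi>_smooth t] dx\<Phi>_pos[OF t] \<Phi>0'[OF aI] neumannD(1,2)[OF N[OF t]] by (simp add: \<Phi>_def)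
  have geodesic: "D2 (psi a b \<alpha> \<mu>) (\<Phi> t) (v'' t) \<phi> + D3 (psi a b \<alpha> \<mu>) (\<Phi> t) (v' t) (v' t) \<phi> = 0"
    if t: "t \<ge> 0" and \<phi>: "\<phi> \<in> test_functions a b" for t \<phi>
  proof -
    have \<phi>1: "\<phi> \<in> Ck a b (Suc 0)" using \<phi> unfolding test_functions_def by blast
    note C1 = slice(2)[OF \<Phi>_smooth t] slice(2)[OF smooth(2) t] slice(2)[OF smooth(3) t]
    note conts = Ck1_continuous[OF C1(1)] Ck1_continuous[OF C1(2)] Ck1_continuous[OF C1(3)] Ck1_continuous[OF \<phi>1]
    have ne: "\<forall>x\<in>{a..b}. dx a b (\<Phi> t) x \<noteq> 0" using dx\<Phi>_pos[OF t] by force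
    let ?A = "\<lambda>x. v'' t x * \<phi> x + \<alpha> * (dx a b (v'' t) x * dx a b \<phi> x / (dx a b (\<Phi> t) x)\<^sup>2)"
    let ?B = "\<lambda>x. - 2 * \<alpha> * (dx a b (v' t) x * dx a b (v' t) x * dx a b \<phi> x / (dx a b (\<Phi> t) x) ^ 3)"
    have cA: "continuous_on {a..b} ?A" and cB: "continuous_on {a..b} ?B"
      by (intro continuous_intros conts; use ne in simp)+
    have "D2 (psi a b \<alpha> \<mu>) (\<Phi> t) (v'' t) \<phi> + D3 (psi a b \<alpha> \<mu>) (\<Phi> t) (v' t) (v' t) \<phi>
        = integral {a..b} (\<lambda>x. \<rho> x * ?A x) + integral {a..b} (\<lambda>x. \<rho> x * ?B x)"
    proof -
      have "D2 (psi a b \<alpha> \<mu>) (\<Phi> t) (v'' t) \<phi> = (LINT x|\<mu>. ?A x)"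
        by (rule D2_psi[OF C1(1) _ C1(3) \<phi>1]) (rule dx\<Phi>_pos[OF t])
      moreover have "D3 (psi a b \<alpha> \<mu>) (\<Phi> t) (v' t) (v' t) \<phi> = (LINT x|\<mu>. ?B x)"
        by (rule D3_psi[OF C1(1) _ C1(2,2) \<phi>1]) (rule dx\<Phi>_pos[OF t])
      ultimately show ?thesis
        by (simp only: lint_eq_integral[OF cA] lint_eq_integral[OF cB])
    qed
    also have "\<dots> = integral {a..b} (\<lambda>x. \<rho> x * ?A x + \<rho> x * ?B x)"
      by (intro integral_add[symmetric] integrable_continuous_interval continuous_on_mult \<rho>_cont cA cB)
    also have "\<dots> = integral {a..b} (\<lambda>x. \<rho> x * (v'' t x * \<phi> x) + dx a b \<phi> x * q'' t x)"
    proof (rule Henstock_Kurzweil_Integration.integral_cong)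
      fix x assume x: "x \<in> {a..b}"
      show "\<rho> x * ?A x + \<rho> x * ?B x = \<rho> x * (v'' t x * \<phi> x) + dx a b \<phi> x * q'' t x"
        unfolding dx\<Phi>[OF t x] dxv[OF t x]
        using \<open>\<alpha> > 0\<close> \<rho>_pos[OF x] y_ne[OF t x] by (intro geodesic_integrand) auto
    qed
    also have "\<dots> = \<phi> b * q'' t b - \<phi> a * q'' t a"
    proof (rule integral_unique[OF fundamental_theorem_of_calculus[of a b "\<lambda>x. \<phi> x * q'' t x"]])
      show "((\<lambda>x. \<phi> x * q'' t x) has_vector_derivative \<rho> x * (v'' t x * \<phi> x) + dx a b \<phi> x * q'' t x) (at x within {a..b})"
        if x: "x \<in> {a..b}" for x
        unfolding has_real_derivative_iff_has_vector_derivative[symmetric]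
        by (rule DERIV_cong[OF DERIV_mult[OF Ck_SucD[OF \<phi>1 x] neumannD(4)[OF N''[OF t] x]]])
           (simp add: algebra_simps)
    qed (use ab in simp)
    also have "\<dots> = 0" using test_function_boundary[OF \<phi>] by simp
    finally show ?thesis .
  qed
  have \<Phi>_init: "\<Phi> 0 x = \<Phi>\<^sub>0 x" if x: "x \<in> {a..b}" for x
  proof -
    have "neumann (\<lambda>x. 0) (\<lambda>x. 0) (\<lambda>x. 0)" by (simp add: neumann_def)
    from neumann_velocity_unique[OF N[OF order_refl] this _ x] show ?thesis
      by (simp add: y_init \<Phi>_def)
  qed
  \<comment> \<open>The choice of \<open>h\<close> makes \<open>(U, u)\<close> a solution of the linear problem for the velocity at time zero.\<close>
  have v_init: "v' 0 x = u x" if x: "x \<in> {a..b}" for x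
  proof -
    let ?p = "\<lambda>x. \<alpha> / (y 0 x)\<^sup>2" and ?s = "\<lambda>x. - (\<alpha> * h x / (y 0 x)\<^sup>2)"
    have cy: "continuous_on {a..b} (y 0)" by (rule jcont_slice[OF j(1)]) simp
    have ne: "\<forall>x\<in>{a..b}. y 0 x \<noteq> 0" using y_ne[OF order_refl] by blast
    have cp: "continuous_on {a..b} ?p" using ne by (intro continuous_intros cy) auto
    have cU: "continuous_on {a..b} U" using U(2) by (rule DERIV_continuous_on)
    have ch: "continuous_on {a..b} h" using lip(2) by (rule lipschitz_on_continuous_on)
    have NU: "neumann U u (\<lambda>x. ?p x * U x + ?s x)"
      unfolding neumann_def
    proof (intro conjI ballI)
      show "continuous_on {a..b} (\<lambda>x. ?p x * U x + ?s x)"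
        using ne by (intro continuous_intros cy cU ch) auto
      fix x assume x: "x \<in> {a..b}"
      have "dx a b u x = \<rho> x * (?p x * U x + ?s x)"
        unfolding y_init[OF x] h_def y0_def
        using \<open>\<alpha> > 0\<close> \<rho>_pos[OF x] \<Phi>0_pos[OF x]
        by (simp add: divide_simps power2_eq_square)
      then show "(u has_real_derivative \<rho> x * (?p x * U x + ?s x)) (at x within {a..b})"
        using Ck_SucD[OF u'(1) x] by simp
    qed (use u U(2) in auto)
    have "neumann (q' 0) (v' 0) (\<lambda>x. ?p x * q' 0 x + ?s x)"
      by (rule neumann_cong[OF N'[OF order_refl]]) (simp add: algebra_simps diff_divide_distrib)
    from neumann_linear_unique(2)[OF this NU cp _ x] show ?thesis using ne \<open>\<alpha> > 0\<close> by simp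
  qed
  have "dual_geodesic a b k (psi a b \<alpha> \<mu>) \<Phi> v' v''"
    unfolding dual_geodesic_def using curves diffeo geodesic by blast
  moreover have "Ck_curve_C2 a b k \<Phi> v' v''"
    unfolding Ck_curve_C2_def using curves by blast
  ultimately show "\<exists>\<Phi> \<Phi>' \<Phi>''.
        dual_geodesic a b k (psi a b \<alpha> \<mu>) \<Phi> \<Phi>' \<Phi>'' \<and>
        Ck_curve_C2 a b k \<Phi> \<Phi>' \<Phi>'' \<and>
        (\<forall>x\<in>{a..b}. \<Phi> 0 x = \<Phi>\<^sub>0 x) \<and>
        (\<forall>x\<in>{a..b}. \<Phi>' 0 x = u x)"
    using \<Phi>_init v_init by blast
qed

end
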